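(* Let $N\in\mathbb{N}$. The map $$\iota_{EM}:(\mathbb{R}^{2d})^N\to\mathfrak{g}_1^*,\qquad\iota_{EM}(\underline{z}_N):=\frac1N\sum_{i=1}^N\delta_{z_i},$$ belongs to $\mathcal{C}^\infty((\mathbb{R}^{2d})^N,\mathfrak{g}_1^* )$ and defines a morphism of Poisson vector spaces from $((\mathbb{R}^{2d})^N,\{\cdot,\cdot\}_N)$ to $(\mathfrak{g}_1^*,\{\cdot,\cdot\}_{\mathfrak{g}_1^*})$, i.e. $\{\mathcal{F}\circ\iota_{EM},\mathcal{G}\circ\iota_{EM}\}_N=\{\mathcal{F},\mathcal{G}\}_{\mathfrak{g}_1^*}\circ\iota_{EM}$ for all $\mathcal{F},\mathcal{G}\in\mathcal{C}^\infty(\mathfrak{g}_1^* )$.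
   Context: Fix $d\in\mathbb{N}$. Points of $\mathbb{R}^{2d}$ are $z=(x,v)$; $\underline{z}_N=(z_1,\dots,z_N)$, $z_i=(x_i,v_i)$. For smooth $F,G$ on $(\mathbb{R}^{2d})^N$, $\{F,G\}_N:=N\sum_{i=1}^N(\nabla_{x_i}F\cdot\nabla_{v_i}G-\nabla_{v_i}F\cdot\nabla_{x_i}G)$ (note the factor $N$). $\mathfrak{g}_1=\mathcal{C}^\infty(\mathbb{R}^{2d})$ (real-valued) with the topology of uniform convergence of all derivatives on compact sets, $[f,g]_{\mathfrak{g}_1}=\nabla_xf\cdot\nabla_vg-\nabla_vf\cdot\nabla_xg$; $\mathfrak{g}_1^*$ is its strong dual (compactly supported distributions). $\mathfrak{g}_1$ is reflexive, so for $\mathcal{F}\in\mathcal{C}^\infty(\mathfrak{g}_1^* )$ the Gâteaux derivative $\mathrm{d}\mathcal{F}[\gamma]$ is identified with an element of $\mathfrak{g}_1$. $\{\mathcal{F},\mathcal{G}\}_{\mathfrak{g}_1^*}(\gamma):=\langle[\mathrm{d}\mathcal{F}[\gamma],\mathrm{d}\mathcal{G}[\gamma]]_{\mathfrak{g}_1},\gamma\rangle_{\mathfrak{g}_1-\mathfrak{g}_1^*}$. Smoothness is in the Gâteaux sense: all iterated directional derivatives $\mathrm{d}^nf:X\times X^n\to Y$ exist and are jointly continuous. *)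

theory Defs
  imports "HOL-Analysis.Analysis"
begin

section \<open>Gateaux smoothness\<close>

class real_tvs = real_vector + topological_monoid_add +
  assumes tendsto_scaleR_Pair: "LIM p (nhds c \<times>\<^sub>F nhds a). fst p *\<^sub>R snd p :> nhds (c *\<^sub>R a)"

instance real_normed_vector \<subseteq> real_tvs
proof
  fix c :: real and a :: 'a
  have "((\<lambda>p. fst p *\<^sub>R snd p) \<longlongrightarrow> c *\<^sub>R a) (nhds (c, a))"
    by (intro tendsto_scaleR tendsto_fst tendsto_snd filterlim_ident[where F = "nhds (c, a)", THEN tendsto_fst, simplified]
        filterlim_ident[where F = "nhds (c, a)", THEN tendsto_snd, simplified])
  then show "LIM p (nhds c \<times>\<^sub>F nhds a). fst p *\<^sub>R snd p :> nhds (c *\<^sub>R a)"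
    by (simp add: nhds_prod)
qed

definition has_gateaux_derivative ::
    "('a::real_tvs \<Rightarrow> 'b::{real_vector, t2_space}) \<Rightarrow> 'b \<Rightarrow> 'a \<Rightarrow> 'a \<Rightarrow> bool"
  where "has_gateaux_derivative f l x h \<longleftrightarrow>
    ((\<lambda>t. (f (x + t *\<^sub>R h) - f x) /\<^sub>R t) \<longlongrightarrow> l) (at 0)"

definition gateaux_derivative ::
    "('a::real_tvs \<Rightarrow> 'b::{real_vector, t2_space}) \<Rightarrow> 'a \<Rightarrow> 'a \<Rightarrow> 'b"
  where "gateaux_derivative f x h = Lim (at 0) (\<lambda>t. (f (x + t *\<^sub>R h) - f x) /\<^sub>R t)"

text \<open>The \<open>n\<close>-th derivative takes its directions from a sequence \<open>h\<close>, of which only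
  \<open>h 0, \<dots>, h (n - 1)\<close> are used. Since the projection from sequences to \<open>n\<close>-tuples is an open
  surjection with a continuous section, continuity in \<open>(x, h)\<close> for the product topology is
  joint continuity on the product of \<open>n + 1\<close> copies of the space.\<close>

primrec iterated_derivative ::
    "('a::real_tvs \<Rightarrow> 'b::{real_vector, t2_space}) \<Rightarrow> nat \<Rightarrow> 'a \<Rightarrow> (nat \<Rightarrow> 'a) \<Rightarrow> 'b" where
  "iterated_derivative f 0 x h = f x"
| "iterated_derivative f (Suc n) x h =
     gateaux_derivative (\<lambda>y. iterated_derivative f n y h) x (h n)"

definition gateaux_smooth :: "('a::real_tvs \<Rightarrow> 'b::{real_vector, t2_space}) \<Rightarrow> bool"
  where "gateaux_smooth f \<longleftrightarrow>
    (\<forall>n. (\<forall>x h. \<exists>l. has_gateaux_derivative (\<lambda>y. iterated_derivative f n y h) l x (h n)) \<and>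
      continuous_on UNIV (\<lambda>(x, h). iterated_derivative f n x h))"

lemma gateaux_derivative_eqI:
  "has_gateaux_derivative f l x h \<Longrightarrow> gateaux_derivative f x h = l"
  unfolding has_gateaux_derivative_def gateaux_derivative_def
  by (rule tendsto_Lim) simp

lemma has_gateaux_derivative_real_iff:
  fixes f :: "'a::real_tvs \<Rightarrow> real"
  shows "has_gateaux_derivative f l x h \<longleftrightarrow> ((\<lambda>t. f (x + t *\<^sub>R h)) has_real_derivative l) (at 0)"
  unfolding has_gateaux_derivative_def DERIV_def
  by (simp add: divide_inverse_commute)

lemma iterated_derivative_cong:
  assumes "\<And>i. i < n \<Longrightarrow> h i = h' i"
  shows "iterated_derivative f n x h = iterated_derivative f n x h'"
  using assms
proof (induction n arbitrary: x)
  case (Suc n)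
  then have "(\<lambda>y. iterated_derivative f n y h) = (\<lambda>y. iterated_derivative f n y h')"
    by auto
  with Suc.prems show ?case by simp
qed simp

lemma gateaux_smooth_iterated:
  assumes "gateaux_smooth f"
  shows "has_gateaux_derivative (\<lambda>y. iterated_derivative f n y h)
    (iterated_derivative f (Suc n) x (h(n := k))) x k"
proof -
  have "has_gateaux_derivative (\<lambda>y. iterated_derivative f n y (h(n := k)))
      (iterated_derivative f (Suc n) x (h(n := k))) x ((h(n := k)) n)"
    using assms unfolding gateaux_smooth_def iterated_derivative.simps
    by (metis gateaux_derivative_eqI)
  moreover have "(\<lambda>y. iterated_derivative f n y (h(n := k))) = (\<lambda>y. iterated_derivative f n y h)"
    by (intro ext iterated_derivative_cong) simp
  ultimately show ?thesis by simp
qed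

lemma gateaux_smooth_iterated':
  assumes "gateaux_smooth f"
  shows "has_gateaux_derivative (\<lambda>y. iterated_derivative f n y h)
    (iterated_derivative f (Suc n) x h) x (h n)"
  using gateaux_smooth_iterated[OF assms, of n h x "h n"] by simp

lemma gateaux_smooth_continuous:
  "gateaux_smooth f \<Longrightarrow> continuous_on UNIV (\<lambda>(x, h). iterated_derivative f n x h)"
  unfolding gateaux_smooth_def by blast

lemma iterated_derivative_eqI:
  assumes "\<And>x h. D 0 x h = f x"
    and "\<And>n x h. has_gateaux_derivative (\<lambda>y. D n y h) (D (Suc n) x h) x (h n)"
  shows "iterated_derivative f = D"
proof
  show "iterated_derivative f n = D n" for n
  proof (induction n)
    case 0
    then show ?case using assms(1) by auto
  next
    case (Suc n)
    then show ?case
      by (intro ext) (simp add: gateaux_derivative_eqI[OF assms(2)])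
  qed
qed

lemma gateaux_smoothI:
  assumes "\<And>x h. D 0 x h = f x"
    and "\<And>n x h. has_gateaux_derivative (\<lambda>y. D n y h) (D (Suc n) x h) x (h n)"
    and "\<And>n. continuous_on UNIV (\<lambda>(x, h). D n x h)"
  shows "gateaux_smooth f"
  unfolding gateaux_smooth_def
  using iterated_derivative_eqI[of D f, OF assms(1,2)] assms(2,3) by auto

lemma gateaux_smooth_coinduct:
  assumes "P (\<lambda>x h. f x)"
    and cont: "\<And>\<Phi>. P \<Phi> \<Longrightarrow> continuous_on UNIV (\<lambda>(x, h). \<Phi> x h)"
    and deriv: "\<And>\<Phi> n. P \<Phi> \<Longrightarrow>
      \<exists>\<Psi>. P \<Psi> \<and> (\<forall>x h. has_gateaux_derivative (\<lambda>y. \<Phi> y h) (\<Psi> x h) x (h (n::nat)))"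
  shows "gateaux_smooth f"
proof -
  have P: "P (iterated_derivative f n)" for n
  proof (induction n)
    case 0
    have "iterated_derivative f 0 = (\<lambda>x h. f x)" by (intro ext) simp
    with assms(1) show ?case by simp
  next
    case (Suc n)
    then obtain \<Psi> where \<Psi>: "P \<Psi>"
        "\<And>x h. has_gateaux_derivative (\<lambda>y. iterated_derivative f n y h) (\<Psi> x h) x (h n)"
      using deriv by meson
    have "iterated_derivative f (Suc n) = \<Psi>"
      by (intro ext) (simp add: gateaux_derivative_eqI[OF \<Psi>(2)])
    with \<Psi>(1) show ?case by simp
  qed
  show ?thesis
    unfolding gateaux_smooth_def using P cont deriv by meson
qed

lemma iterated_derivative_const:
  fixes c :: real
  shows "iterated_derivative (\<lambda>_::'a::real_tvs. c) = (\<lambda>n x h. if n = 0 then c else 0)"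
  by (rule iterated_derivative_eqI) (simp_all add: has_gateaux_derivative_def)

lemma gateaux_smooth_const: "gateaux_smooth (\<lambda>_::'a::real_tvs. c::real)"
  by (rule gateaux_smoothI[where D = "\<lambda>n x h. if n = 0 then c else 0"])
     (simp_all add: has_gateaux_derivative_def)

context
  fixes f g :: "'a::real_tvs \<Rightarrow> real"
  assumes f: "gateaux_smooth f" and g: "gateaux_smooth g"
begin

lemma has_gateaux_derivative_iterated_add:
  "has_gateaux_derivative (\<lambda>y. iterated_derivative f n y h + iterated_derivative g n y h)
    (iterated_derivative f (Suc n) x h + iterated_derivative g (Suc n) x h) x (h n)"
  using f[THEN gateaux_smooth_iterated'] g[THEN gateaux_smooth_iterated']
  unfolding has_gateaux_derivative_real_iff by (rule DERIV_add)

lemma iterated_derivative_add: "iterated_derivative (\<lambda>x. f x + g x) =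
    (\<lambda>n x h. iterated_derivative f n x h + iterated_derivative g n x h)"
  by (rule iterated_derivative_eqI, simp) (rule has_gateaux_derivative_iterated_add)

lemma gateaux_smooth_add: "gateaux_smooth (\<lambda>x. f x + g x)"
  by (rule gateaux_smoothI[OF _ has_gateaux_derivative_iterated_add])
     (use f[THEN gateaux_smooth_continuous] g[THEN gateaux_smooth_continuous] in
       \<open>auto simp: case_prod_unfold intro!: continuous_on_add\<close>)

inductive product_terms :: "('a \<Rightarrow> (nat \<Rightarrow> 'a) \<Rightarrow> real) \<Rightarrow> bool" where
  base: "product_terms (\<lambda>x h. iterated_derivative f m x (h \<circ> \<sigma>) * iterated_derivative g n x (h \<circ> \<tau>))"
| add: "product_terms \<Phi> \<Longrightarrow> product_terms \<Psi> \<Longrightarrow> product_terms (\<lambda>x h. \<Phi> x h + \<Psi> x h)"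

lemma continuous_on_reindex:
  fixes F :: "'a \<Rightarrow> (nat \<Rightarrow> 'a) \<Rightarrow> real" and \<sigma> :: "nat \<Rightarrow> nat"
  assumes "continuous_on UNIV (\<lambda>(x, h). F x h)"
  shows "continuous_on UNIV (\<lambda>(x, h). F x (h \<circ> \<sigma>))"
proof -
  have c: "continuous_on UNIV (\<lambda>p::'a \<times> (nat \<Rightarrow> 'a). (fst p, snd p \<circ> \<sigma>))"
    unfolding o_def
    by (intro continuous_on_Pair continuous_on_fst continuous_on_id
        continuous_on_coordinatewise_then_product
        continuous_on_product_then_coordinatewise[OF continuous_on_snd[OF continuous_on_id]])
  show ?thesis
    using continuous_on_compose2[OF assms c] by (simp add: case_prod_unfold)
qed

lemma gateaux_smooth_mult: "gateaux_smooth (\<lambda>x. f x * g x)"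
proof (rule gateaux_smooth_coinduct[where P = product_terms])
  show "product_terms (\<lambda>x h. f x * g x)"
    using product_terms.base[of 0 id 0 id] by simp
next
  show "continuous_on UNIV (\<lambda>(x, h). \<Phi> x h)" if "product_terms \<Phi>" for \<Phi>
    using that
  proof induction
    case (base m \<sigma> n \<tau>)
    show ?case
      using continuous_on_mult[OF continuous_on_reindex[OF f[THEN gateaux_smooth_continuous]]
          continuous_on_reindex[OF g[THEN gateaux_smooth_continuous]]]
      by (simp add: case_prod_unfold)
  next
    case (add \<Phi> \<Psi>)
    then show ?case by (auto simp: case_prod_unfold intro!: continuous_on_add)
  qed
next
  show "\<exists>\<Psi>. product_terms \<Psi> \<and> (\<forall>x h. has_gateaux_derivative (\<lambda>y. \<Phi> y h) (\<Psi> x h) x (h k))"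
    if "product_terms \<Phi>" for \<Phi> k
    using that
  proof induction
    case (base m \<sigma> n \<tau>)
    let ?\<Psi> = "\<lambda>x h. iterated_derivative f (Suc m) x (h \<circ> \<sigma>(m := k)) * iterated_derivative g n x (h \<circ> \<tau>)
        + iterated_derivative f m x (h \<circ> \<sigma>) * iterated_derivative g (Suc n) x (h \<circ> \<tau>(n := k))"
    have "has_gateaux_derivative
        (\<lambda>y. iterated_derivative f m y (h \<circ> \<sigma>) * iterated_derivative g n y (h \<circ> \<tau>)) (?\<Psi> x h) x (h k)"
      for x h
    proof -
      have eq: "h \<circ> \<rho>(j := k) = (h \<circ> \<rho>)(j := h k)" for \<rho> and j :: nat
        by auto
      show ?thesis
        using f[THEN gateaux_smooth_iterated, of m "h \<circ> \<sigma>" x "h k"]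
          g[THEN gateaux_smooth_iterated, of n "h \<circ> \<tau>" x "h k"]
        unfolding has_gateaux_derivative_real_iff eq
        by (auto dest: DERIV_mult simp: algebra_simps simp del: iterated_derivative.simps)
    qed
    moreover have "product_terms ?\<Psi>"
      by (intro product_terms.intros)
    ultimately show ?case by blast
  next
    case (add \<Phi>1 \<Phi>2)
    then obtain \<Psi>1 \<Psi>2 where *: "product_terms \<Psi>1" "product_terms \<Psi>2"
      "\<And>x h. has_gateaux_derivative (\<lambda>y. \<Phi>1 y h) (\<Psi>1 x h) x (h k)"
      "\<And>x h. has_gateaux_derivative (\<lambda>y. \<Phi>2 y h) (\<Psi>2 x h) x (h k)"
      by blast
    have "product_terms (\<lambda>x h. \<Psi>1 x h + \<Psi>2 x h)"
      using *(1,2) by (rule product_terms.add)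
    moreover have "has_gateaux_derivative (\<lambda>y. \<Phi>1 y h + \<Phi>2 y h) (\<Psi>1 x h + \<Psi>2 x h) x (h k)" for x h
      using *(3,4) unfolding has_gateaux_derivative_real_iff by (rule DERIV_add)
    ultimately show ?case by blast
  qed
qed

end

lemma has_gateaux_derivative_iterated_scale:
  fixes f :: "'a::real_tvs \<Rightarrow> real"
  assumes "gateaux_smooth f"
  shows "has_gateaux_derivative (\<lambda>y. c * iterated_derivative f n y h)
    (c * iterated_derivative f (Suc n) x h) x (h n)"
  using gateaux_smooth_iterated'[OF assms]
  unfolding has_gateaux_derivative_real_iff by (rule DERIV_cmult)

lemma iterated_derivative_scale:
  fixes f :: "'a::real_tvs \<Rightarrow> real"
  assumes "gateaux_smooth f"
  shows "iterated_derivative (\<lambda>x. c * f x) = (\<lambda>n x h. c * iterated_derivative f n x h)"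
  by (rule iterated_derivative_eqI, simp)
     (rule has_gateaux_derivative_iterated_scale[OF assms])

lemma gateaux_smooth_scale:
  fixes f :: "'a::real_tvs \<Rightarrow> real"
  assumes "gateaux_smooth f"
  shows "gateaux_smooth (\<lambda>x. c * f x)"
  by (rule gateaux_smoothI[OF _ has_gateaux_derivative_iterated_scale[OF assms]])
     (use gateaux_smooth_continuous[OF assms] in
       \<open>auto simp: case_prod_unfold intro!: continuous_on_mult_left\<close>)

lemma gateaux_smooth_uminus:
  "gateaux_smooth (f :: 'a::real_tvs \<Rightarrow> real) \<Longrightarrow> gateaux_smooth (\<lambda>x. - f x)"
  using gateaux_smooth_scale[of f "-1"] by simp

lemma gateaux_smooth_diff:
  fixes f g :: "'a::real_tvs \<Rightarrow> real"
  assumes "gateaux_smooth f" "gateaux_smooth g"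
  shows "gateaux_smooth (\<lambda>x. f x - g x)"
  using gateaux_smooth_add[OF assms(1) gateaux_smooth_uminus[OF assms(2)]] by simp

lemma gateaux_smooth_sum:
  fixes f :: "'i \<Rightarrow> 'a::real_tvs \<Rightarrow> real"
  assumes "\<And>i. i \<in> I \<Longrightarrow> gateaux_smooth (f i)"
  shows "gateaux_smooth (\<lambda>x. \<Sum>i\<in>I. f i x)"
  using assms
  by (induction I rule: infinite_finite_induct) (auto intro: gateaux_smooth_const gateaux_smooth_add)

lemma gateaux_smooth_derivative:
  fixes f :: "'a::real_tvs \<Rightarrow> real"
  assumes "gateaux_smooth f"
  shows "gateaux_smooth (\<lambda>x. gateaux_derivative f x e)"
proof (rule gateaux_smoothI)
  let ?D = "\<lambda>n x h. iterated_derivative f (Suc n) x (case_nat e h)"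
  show "?D 0 x h = gateaux_derivative f x e" for x h
    by simp
  show "has_gateaux_derivative (\<lambda>y. ?D n y h) (?D (Suc n) x h) x (h n)" for n x h
    using gateaux_smooth_iterated'[OF assms, of "Suc n" "case_nat e h" x] by simp
  have "continuous_on UNIV (\<lambda>p::'a \<times> (nat \<Rightarrow> 'a). (fst p, case_nat e (snd p)))"
  proof (intro continuous_on_Pair continuous_on_fst continuous_on_id
      continuous_on_coordinatewise_then_product)
    show "continuous_on UNIV (\<lambda>p::'a \<times> (nat \<Rightarrow> 'a). case_nat e (snd p) i)" for i
      by (cases i)
         (auto intro: continuous_on_product_then_coordinatewise[OF continuous_on_snd[OF continuous_on_id]])
  qed
  from continuous_on_compose2[OF gateaux_smooth_continuous[OF assms] this]
  show "continuous_on UNIV (\<lambda>(x, h). ?D n x h)" for n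
    by (simp add: case_prod_unfold del: iterated_derivative.simps)
qed

section \<open>The space of smooth functions\<close>

text \<open>On a Euclidean space, \<^const>\<open>gateaux_smooth\<close> is the classical infinite differentiability.\<close>

typedef (overloaded) 'a smooth_fun = "{f :: 'a::euclidean_space \<Rightarrow> real. gateaux_smooth f}"
  morphisms smooth_apply Abs_smooth_fun
  using gateaux_smooth_const by blast

setup_lifting type_definition_smooth_fun

lemma gateaux_smooth_apply: "gateaux_smooth (smooth_apply f)"
  using smooth_apply by blast

instantiation smooth_fun :: (euclidean_space) real_vector
begin

lift_definition zero_smooth_fun :: "'a smooth_fun" is "\<lambda>_. 0"
  by (rule gateaux_smooth_const)
lift_definition plus_smooth_fun :: "'a smooth_fun \<Rightarrow> 'a smooth_fun \<Rightarrow> 'a smooth_fun"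
  is "\<lambda>f g x. f x + g x" by (rule gateaux_smooth_add)
lift_definition minus_smooth_fun :: "'a smooth_fun \<Rightarrow> 'a smooth_fun \<Rightarrow> 'a smooth_fun"
  is "\<lambda>f g x. f x - g x" by (rule gateaux_smooth_diff)
lift_definition uminus_smooth_fun :: "'a smooth_fun \<Rightarrow> 'a smooth_fun"
  is "\<lambda>f x. - f x" by (rule gateaux_smooth_uminus)
lift_definition scaleR_smooth_fun :: "real \<Rightarrow> 'a smooth_fun \<Rightarrow> 'a smooth_fun"
  is "\<lambda>c f x. c * f x" by (rule gateaux_smooth_scale)

instance
  by standard (transfer; simp add: algebra_simps)+

end

text \<open>Basic neighbourhoods for uniform convergence of all derivatives on compact sets: directions
  range over the standard basis, so the derivatives compared are the partial derivatives of
  order at most \<open>m\<close>.\<close>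

definition smooth_nhd ::
    "'a::euclidean_space set \<Rightarrow> nat \<Rightarrow> real \<Rightarrow> 'a smooth_fun \<Rightarrow> 'a smooth_fun set"
  where "smooth_nhd K m \<epsilon> f = {g. \<forall>n\<le>m. \<forall>x\<in>K. \<forall>h. range h \<subseteq> Basis \<longrightarrow>
    \<bar>iterated_derivative (smooth_apply g) n x h - iterated_derivative (smooth_apply f) n x h\<bar> < \<epsilon>}"

lemma smooth_nhdD:
  "g \<in> smooth_nhd K m \<epsilon> f \<Longrightarrow> n \<le> m \<Longrightarrow> x \<in> K \<Longrightarrow> range h \<subseteq> Basis \<Longrightarrow>
    \<bar>iterated_derivative (smooth_apply g) n x h - iterated_derivative (smooth_apply f) n x h\<bar> < \<epsilon>"
  unfolding smooth_nhd_def by blast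

lemma smooth_nhd_mono:
  assumes "K \<subseteq> K'" "m \<le> m'" "\<epsilon>' \<le> \<epsilon>"
  shows "smooth_nhd K' m' \<epsilon>' f \<subseteq> smooth_nhd K m \<epsilon> f"
proof
  fix g assume g: "g \<in> smooth_nhd K' m' \<epsilon>' f"
  show "g \<in> smooth_nhd K m \<epsilon> f"
    unfolding smooth_nhd_def
  proof (intro CollectI allI impI ballI)
    fix n x and h :: "nat \<Rightarrow> 'a" assume "n \<le> m" "x \<in> K" "range h \<subseteq> Basis"
    with assms have "n \<le> m'" "x \<in> K'" "range h \<subseteq> Basis" by auto
    from smooth_nhdD[OF g this] assms(3)
    show "\<bar>iterated_derivative (smooth_apply g) n x h - iterated_derivative (smooth_apply f) n x h\<bar> < \<epsilon>"
      by linarith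
  qed
qed

instantiation smooth_fun :: (euclidean_space) topological_space
begin

definition open_smooth_fun :: "'a smooth_fun set \<Rightarrow> bool"
  where "open_smooth_fun U \<longleftrightarrow>
    (\<forall>f\<in>U. \<exists>K m \<epsilon>. compact K \<and> \<epsilon> > 0 \<and> smooth_nhd K m \<epsilon> f \<subseteq> U)"

instance
proof
  show "open (UNIV :: 'a smooth_fun set)"
    unfolding open_smooth_fun_def using compact_empty zero_less_one by blast
next
  fix S T :: "'a smooth_fun set"
  assume ST: "open S" "open T"
  show "open (S \<inter> T)"
    unfolding open_smooth_fun_def
  proof
    fix f assume "f \<in> S \<inter> T"
    with ST obtain K m \<epsilon> K' m' \<epsilon>' where *:
      "compact K" "\<epsilon> > 0" "smooth_nhd K m \<epsilon> f \<subseteq> S" "compact K'" "\<epsilon>' > 0" "smooth_nhd K' m' \<epsilon>' f \<subseteq> T"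
      unfolding open_smooth_fun_def by (meson IntD1 IntD2)
    have "smooth_nhd (K \<union> K') (max m m') (min \<epsilon> \<epsilon>') f \<subseteq> smooth_nhd K m \<epsilon> f"
      "smooth_nhd (K \<union> K') (max m m') (min \<epsilon> \<epsilon>') f \<subseteq> smooth_nhd K' m' \<epsilon>' f"
      by (rule smooth_nhd_mono; simp)+
    with *(3,6) have "smooth_nhd (K \<union> K') (max m m') (min \<epsilon> \<epsilon>') f \<subseteq> S \<inter> T"
      by blast
    moreover have "compact (K \<union> K')" "min \<epsilon> \<epsilon>' > 0"
      using * by (simp_all add: compact_Un)
    ultimately show "\<exists>K m \<epsilon>. compact K \<and> \<epsilon> > 0 \<and> smooth_nhd K m \<epsilon> f \<subseteq> S \<inter> T"
      by blast
  qed
next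
  fix \<U> :: "'a smooth_fun set set"
  assume "\<forall>S\<in>\<U>. open S"
  then show "open (\<Union>\<U>)"
    unfolding open_smooth_fun_def
  proof (intro ballI)
    fix f assume *: "\<forall>S\<in>\<U>. \<forall>f\<in>S. \<exists>K m \<epsilon>. compact K \<and> \<epsilon> > 0 \<and> smooth_nhd K m \<epsilon> f \<subseteq> S" "f \<in> \<Union>\<U>"
    from *(2) obtain S where "S \<in> \<U>" "f \<in> S" by (rule UnionE)
    from *(1)[rule_format, OF this] obtain K m \<epsilon>
      where K: "compact K" "\<epsilon> > 0" "smooth_nhd K m \<epsilon> f \<subseteq> S" by meson
    show "\<exists>K m \<epsilon>. compact K \<and> \<epsilon> > 0 \<and> smooth_nhd K m \<epsilon> f \<subseteq> \<Union>\<U>"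
      using K(1,2) order_trans[OF K(3) Union_upper[OF \<open>S \<in> \<U>\<close>]]
      by (intro exI[of _ K] exI[of _ m] exI[of _ \<epsilon>]) simp
  qed
qed

end

lemma eventually_nhds_smooth_fun:
  "eventually P (nhds f) \<longleftrightarrow>
    (\<exists>K m \<epsilon>. compact K \<and> \<epsilon> > 0 \<and> (\<forall>g\<in>smooth_nhd K m \<epsilon> f. P g))"
proof
  assume "eventually P (nhds f)"
  then obtain U where U: "open U" "f \<in> U" "\<And>g. g \<in> U \<Longrightarrow> P g"
    unfolding eventually_nhds by blast
  from U(1,2) obtain K m \<epsilon> where K: "compact K" "\<epsilon> > 0" "smooth_nhd K m \<epsilon> f \<subseteq> U"
    unfolding open_smooth_fun_def by meson
  show "\<exists>K m \<epsilon>. compact K \<and> \<epsilon> > 0 \<and> (\<forall>g\<in>smooth_nhd K m \<epsilon> f. P g)"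
    using K(1,2) U(3)[OF subsetD[OF K(3)]] by (intro exI[of _ K] exI[of _ m] exI[of _ \<epsilon>]) simp
next
  assume "\<exists>K m \<epsilon>. compact K \<and> \<epsilon> > 0 \<and> (\<forall>g\<in>smooth_nhd K m \<epsilon> f. P g)"
  then obtain K m \<epsilon> where *: "compact K" "\<epsilon> > 0" "\<forall>g\<in>smooth_nhd K m \<epsilon> f. P g"
    by meson
  define Q where "Q \<delta> g \<longleftrightarrow> (\<forall>n\<le>m. \<forall>x\<in>K. \<forall>h. range h \<subseteq> Basis \<longrightarrow>
    \<bar>iterated_derivative (smooth_apply g) n x h - iterated_derivative (smooth_apply f) n x h\<bar> \<le> \<delta>)"
    for \<delta> g
  define U where "U = {g. \<exists>\<delta>>0. \<delta> < \<epsilon> \<and> Q \<delta> g}"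
  have "open U"
    unfolding open_smooth_fun_def
  proof
    fix g assume "g \<in> U"
    then obtain \<delta> where \<delta>: "0 < \<delta>" "\<delta> < \<epsilon>" and g: "Q \<delta> g"
      unfolding U_def by auto
    have "smooth_nhd K m ((\<epsilon> - \<delta>) / 2) g \<subseteq> U"
    proof
      fix k assume k: "k \<in> smooth_nhd K m ((\<epsilon> - \<delta>) / 2) g"
      have "Q ((\<epsilon> + \<delta>) / 2) k"
        unfolding Q_def
      proof (intro allI impI ballI)
        fix n x and h :: "nat \<Rightarrow> 'a" assume nxh: "n \<le> m" "x \<in> K" "range h \<subseteq> Basis"
        have "\<bar>iterated_derivative (smooth_apply g) n x h - iterated_derivative (smooth_apply f) n x h\<bar> \<le> \<delta>"
          using g nxh unfolding Q_def by simp
        with smooth_nhdD[OF k nxh]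
        show "\<bar>iterated_derivative (smooth_apply k) n x h - iterated_derivative (smooth_apply f) n x h\<bar>
            \<le> (\<epsilon> + \<delta>) / 2"
          unfolding diff_divide_distrib add_divide_distrib by linarith
      qed
      moreover have "0 < (\<epsilon> + \<delta>) / 2" "(\<epsilon> + \<delta>) / 2 < \<epsilon>" using \<delta> by auto
      ultimately show "k \<in> U" unfolding U_def mem_Collect_eq by metis
    qed
    with \<open>compact K\<close> \<delta> show "\<exists>K m \<epsilon>. compact K \<and> \<epsilon> > 0 \<and> smooth_nhd K m \<epsilon> g \<subseteq> U"
      by (intro exI[of _ K] exI[of _ m] exI[of _ "(\<epsilon> - \<delta>) / 2"]) simp
  qed
  moreover have "f \<in> U"
    unfolding U_def Q_def using \<open>\<epsilon> > 0\<close> by (auto intro!: exI[of _ "\<epsilon> / 2"])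
  moreover have "P g" if "g \<in> U" for g
  proof (rule *(3)[rule_format])
    from that obtain \<delta> where \<delta>: "\<delta> < \<epsilon>" "Q \<delta> g"
      unfolding U_def by auto
    show "g \<in> smooth_nhd K m \<epsilon> f"
      unfolding smooth_nhd_def
    proof (intro CollectI allI impI ballI)
      fix n x and h :: "nat \<Rightarrow> 'a" assume "n \<le> m" "x \<in> K" "range h \<subseteq> Basis"
      with \<delta>(2) have "\<bar>iterated_derivative (smooth_apply g) n x h - iterated_derivative (smooth_apply f) n x h\<bar> \<le> \<delta>"
        unfolding Q_def by simp
      with \<delta>(1) show "\<bar>iterated_derivative (smooth_apply g) n x h - iterated_derivative (smooth_apply f) n x h\<bar> < \<epsilon>"
        by linarith
    qed
  qed
  ultimately show "eventually P (nhds f)"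
    unfolding eventually_nhds by metis
qed

lemma iterated_derivative_bounded:
  fixes f :: "'a::euclidean_space \<Rightarrow> real"
  assumes "gateaux_smooth f" "compact K"
  shows "\<exists>C. \<forall>n\<le>m. \<forall>x\<in>K. \<forall>h. range h \<subseteq> Basis \<longrightarrow> \<bar>iterated_derivative f n x h\<bar> \<le> C"
proof -
  let ?H = "{..<m} \<rightarrow>\<^sub>E (Basis :: 'a set)"
  have "compact ((\<lambda>x. iterated_derivative f n x h) ` K)" for n h
  proof (rule compact_continuous_image[OF _ assms(2)])
    have "continuous_on UNIV (\<lambda>x. (x, h))"
      by (intro continuous_on_Pair continuous_on_id continuous_on_const)
    from continuous_on_compose2[OF gateaux_smooth_continuous[OF assms(1), of n] this]
    show "continuous_on K (\<lambda>x. iterated_derivative f n x h)"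
      by (auto intro: continuous_on_subset)
  qed
  moreover have "finite ?H"
    by (intro finite_PiE) simp_all
  ultimately have "bounded (\<Union>n\<in>{..m}. \<Union>h\<in>?H. (\<lambda>x. iterated_derivative f n x h) ` K)"
    by (intro bounded_UN finite_atMost ballI compact_imp_bounded)
  then obtain C where C: "\<forall>y\<in>(\<Union>n\<in>{..m}. \<Union>h\<in>?H. (\<lambda>x. iterated_derivative f n x h) ` K). norm y \<le> C"
    unfolding bounded_iff by meson
  have "\<bar>iterated_derivative f n x h\<bar> \<le> C" if "n \<le> m" "x \<in> K" "range h \<subseteq> Basis" for n x h
  proof -
    have "restrict h {..<m} \<in> ?H"
      using that(3) by (simp add: restrict_PiE_iff image_subset_iff)
    with that(1,2) have in_Un: "iterated_derivative f n x (restrict h {..<m}) \<in>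
        (\<Union>n\<in>{..m}. \<Union>h\<in>?H. (\<lambda>x. iterated_derivative f n x h) ` K)"
      by (intro UN_I[of n] UN_I[of "restrict h {..<m}"] imageI) simp_all
    have "iterated_derivative f n x h = iterated_derivative f n x (restrict h {..<m})"
      using that(1) by (intro iterated_derivative_cong) simp
    with bspec[OF C in_Un] show ?thesis by simp
  qed
  then show ?thesis by (intro exI[of _ C]) simp
qed

lemma scale_estimate:
  fixes s c u a \<epsilon> C :: real
  assumes "\<epsilon> > 0" "C \<ge> 0" "\<bar>a\<bar> \<le> C" "\<bar>s - c\<bar> < min 1 (\<epsilon> / (2 * (C + 1)))"
    and "\<bar>u - a\<bar> < \<epsilon> / (2 * (\<bar>c\<bar> + 1))"
  shows "\<bar>s * u - c * a\<bar> < \<epsilon>"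
proof -
  have "\<bar>s\<bar> \<le> \<bar>c\<bar> + 1" using assms(4) by linarith
  then have "\<bar>s\<bar> * \<bar>u - a\<bar> \<le> (\<bar>c\<bar> + 1) * \<bar>u - a\<bar>"
    by (rule mult_right_mono) simp
  also have "\<dots> < (\<bar>c\<bar> + 1) * (\<epsilon> / (2 * (\<bar>c\<bar> + 1)))"
    using assms(5) by (intro mult_strict_left_mono) auto
  also have "\<dots> = \<epsilon> / 2"
    using add_nonneg_pos[of "\<bar>c\<bar>" 1] by (simp add: field_simps)
  finally have 1: "\<bar>s\<bar> * \<bar>u - a\<bar> < \<epsilon> / 2" .
  have "\<bar>s - c\<bar> * \<bar>a\<bar> \<le> \<epsilon> / (2 * (C + 1)) * C"
    using assms by (intro mult_mono) auto
  also have "\<dots> \<le> \<epsilon> / 2"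
    using assms(1,2) by (simp add: field_simps)
  finally have 2: "\<bar>s - c\<bar> * \<bar>a\<bar> \<le> \<epsilon> / 2" .
  have "s * u - c * a = s * (u - a) + (s - c) * a"
    by (simp add: algebra_simps)
  then have "\<bar>s * u - c * a\<bar> \<le> \<bar>s\<bar> * \<bar>u - a\<bar> + \<bar>s - c\<bar> * \<bar>a\<bar>"
    by (metis abs_mult abs_triangle_ineq)
  with 1 2 show ?thesis by linarith
qed

lemma smooth_apply_add: "smooth_apply (f + g) = (\<lambda>x. smooth_apply f x + smooth_apply g x)"
  by transfer simp

lemma smooth_apply_scaleR: "smooth_apply (c *\<^sub>R f) = (\<lambda>x. c * smooth_apply f x)"
  by transfer simp

instance smooth_fun :: (euclidean_space) real_tvs
proof
  fix a b :: "'a smooth_fun"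
  show "LIM p (nhds a \<times>\<^sub>F nhds b). fst p + snd p :> nhds (a + b)"
    unfolding filterlim_iff
  proof (intro allI impI)
    fix P assume "eventually P (nhds (a + b))"
    then obtain K m \<epsilon> where *: "compact K" "\<epsilon> > 0" "\<forall>g\<in>smooth_nhd K m \<epsilon> (a + b). P g"
      unfolding eventually_nhds_smooth_fun by meson
    have "P (f + g)" if f: "f \<in> smooth_nhd K m (\<epsilon> / 2) a" and g: "g \<in> smooth_nhd K m (\<epsilon> / 2) b" for f g
    proof (rule *(3)[rule_format])
      show "f + g \<in> smooth_nhd K m \<epsilon> (a + b)"
        unfolding smooth_nhd_def
      proof (intro CollectI allI impI ballI)
        fix n x and h :: "nat \<Rightarrow> 'a" assume nxh: "n \<le> m" "x \<in> K" "range h \<subseteq> Basis"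
        from smooth_nhdD[OF f nxh] smooth_nhdD[OF g nxh]
        show "\<bar>iterated_derivative (smooth_apply (f + g)) n x h -
            iterated_derivative (smooth_apply (a + b)) n x h\<bar> < \<epsilon>"
          unfolding smooth_apply_add iterated_derivative_add[OF gateaux_smooth_apply gateaux_smooth_apply]
          by linarith
      qed
    qed
    moreover have "eventually (\<lambda>f. f \<in> smooth_nhd K m (\<epsilon> / 2) c) (nhds c)" for c
      unfolding eventually_nhds_smooth_fun using *(1) half_gt_zero[OF *(2)] by meson
    ultimately show "eventually (\<lambda>p. P (fst p + snd p)) (nhds a \<times>\<^sub>F nhds b)"
      unfolding eventually_prod_filter
      by (intro exI[of _ "\<lambda>f. f \<in> smooth_nhd K m (\<epsilon> / 2) a"]
          exI[of _ "\<lambda>g. g \<in> smooth_nhd K m (\<epsilon> / 2) b"]) simp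
  qed
next
  fix c :: real and a :: "'a smooth_fun"
  show "LIM p (nhds c \<times>\<^sub>F nhds a). fst p *\<^sub>R snd p :> nhds (c *\<^sub>R a)"
    unfolding filterlim_iff
  proof (intro allI impI)
    fix P assume "eventually P (nhds (c *\<^sub>R a))"
    then obtain K m \<epsilon> where *: "compact K" "\<epsilon> > 0" "\<forall>g\<in>smooth_nhd K m \<epsilon> (c *\<^sub>R a). P g"
      unfolding eventually_nhds_smooth_fun by meson
    obtain C0 where C0: "\<forall>n\<le>m. \<forall>x\<in>K. \<forall>h. range h \<subseteq> Basis \<longrightarrow>
        \<bar>iterated_derivative (smooth_apply a) n x h\<bar> \<le> C0"
      using iterated_derivative_bounded[OF gateaux_smooth_apply *(1)] by meson
    define C where "C = max C0 0"
    have C: "\<bar>iterated_derivative (smooth_apply a) n x h\<bar> \<le> C"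
      if "n \<le> m" "x \<in> K" "range h \<subseteq> Basis" for n x h
      using C0[rule_format, OF that] unfolding C_def by simp
    have C_pos: "C \<ge> 0" unfolding C_def by simp
    define \<delta> where "\<delta> = \<epsilon> / (2 * (\<bar>c\<bar> + 1))"
    define \<eta> where "\<eta> = min 1 (\<epsilon> / (2 * (C + 1)))"
    have pos: "\<delta> > 0" "\<eta> > 0"
      using *(2) C_pos by (auto simp: \<delta>_def \<eta>_def)
    have "P (s *\<^sub>R f)" if s: "\<bar>s - c\<bar> < \<eta>" and f: "f \<in> smooth_nhd K m \<delta> a" for s f
    proof (rule *(3)[rule_format])
      show "s *\<^sub>R f \<in> smooth_nhd K m \<epsilon> (c *\<^sub>R a)"
        unfolding smooth_nhd_def
      proof (intro CollectI allI impI ballI)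
        fix n x and h :: "nat \<Rightarrow> 'a" assume nxh: "n \<le> m" "x \<in> K" "range h \<subseteq> Basis"
        have "\<bar>s * iterated_derivative (smooth_apply f) n x h -
            c * iterated_derivative (smooth_apply a) n x h\<bar> < \<epsilon>"
          using *(2) C_pos C[OF nxh] s smooth_nhdD[OF f nxh]
          unfolding \<eta>_def \<delta>_def by (rule scale_estimate)
        then show "\<bar>iterated_derivative (smooth_apply (s *\<^sub>R f)) n x h -
            iterated_derivative (smooth_apply (c *\<^sub>R a)) n x h\<bar> < \<epsilon>"
          unfolding smooth_apply_scaleR iterated_derivative_scale[OF gateaux_smooth_apply] .
      qed
    qed
    moreover have "eventually (\<lambda>s. \<bar>s - c\<bar> < \<eta>) (nhds c)"
      using pos unfolding eventually_nhds_metric dist_real_def by auto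
    moreover have "eventually (\<lambda>f. f \<in> smooth_nhd K m \<delta> a) (nhds a)"
      unfolding eventually_nhds_smooth_fun using *(1) pos(1) by meson
    ultimately show "eventually (\<lambda>p. P (fst p *\<^sub>R snd p)) (nhds c \<times>\<^sub>F nhds a)"
      unfolding eventually_prod_filter
      by (intro exI[of _ "\<lambda>s. \<bar>s - c\<bar> < \<eta>"] exI[of _ "\<lambda>f. f \<in> smooth_nhd K m \<delta> a"]) simp
  qed
qed

section \<open>The strong dual\<close>

definition tvs_bounded :: "'a::real_tvs set \<Rightarrow> bool"
  where "tvs_bounded B \<longleftrightarrow>
    (\<forall>U. open U \<longrightarrow> 0 \<in> U \<longrightarrow> (\<exists>r>0. \<forall>t\<ge>r. B \<subseteq> (\<lambda>u. t *\<^sub>R u) ` U))"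

lemma tvs_bounded_empty: "tvs_bounded {}"
  unfolding tvs_bounded_def by (auto intro: zero_less_one)

lemma tvs_bounded_Un:
  assumes "tvs_bounded A" "tvs_bounded B"
  shows "tvs_bounded (A \<union> B)"
  unfolding tvs_bounded_def
proof (intro allI impI)
  fix U :: "'a set" assume "open U" "0 \<in> U"
  then obtain r s where "r > 0" "s > 0" "\<forall>t\<ge>r. A \<subseteq> (\<lambda>u. t *\<^sub>R u) ` U" "\<forall>t\<ge>s. B \<subseteq> (\<lambda>u. t *\<^sub>R u) ` U"
    using assms unfolding tvs_bounded_def by meson
  then show "\<exists>r>0. \<forall>t\<ge>r. A \<union> B \<subseteq> (\<lambda>u. t *\<^sub>R u) ` U"
    by (intro exI[of _ "max r s"]) auto
qed

lemma tendsto_scaleR_tvs: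
  fixes g :: "'b \<Rightarrow> 'a::real_tvs"
  assumes "(c \<longlongrightarrow> l) F" "(g \<longlongrightarrow> a) F"
  shows "((\<lambda>x. c x *\<^sub>R g x) \<longlongrightarrow> l *\<^sub>R a) F"
  using filterlim_compose[OF tendsto_scaleR_Pair, of "\<lambda>x. (c x, g x)" l a F] assms
  by (simp add: nhds_prod[symmetric] tendsto_Pair)

lemma tvs_bounded_singleton: "tvs_bounded {a :: 'a::real_tvs}"
  unfolding tvs_bounded_def
proof (intro allI impI)
  fix U :: "'a set" assume U: "open U" "0 \<in> U"
  have "((\<lambda>t. inverse t *\<^sub>R a) \<longlongrightarrow> 0 *\<^sub>R a) at_top"
    by (intro tendsto_scaleR_tvs tendsto_inverse_0_at_top filterlim_ident tendsto_const)
  then have "eventually (\<lambda>t. inverse t *\<^sub>R a \<in> U) at_top"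
    using U by (simp add: tendsto_def)
  then obtain r where r: "\<And>t. t \<ge> r \<Longrightarrow> inverse t *\<^sub>R a \<in> U"
    unfolding eventually_at_top_linorder by blast
  have "a \<in> (\<lambda>u. t *\<^sub>R u) ` U" if "t \<ge> max r 1" for t
    using r[of t] that by (intro image_eqI[of _ _ "inverse t *\<^sub>R a"]) auto
  then show "\<exists>r>0. \<forall>t\<ge>r. {a} \<subseteq> (\<lambda>u. t *\<^sub>R u) ` U"
    by (intro exI[of _ "max r 1"]) auto
qed

typedef (overloaded) 'a strong_dual =
    "{\<phi> :: 'a::real_tvs \<Rightarrow> real. linear \<phi> \<and> continuous_on UNIV \<phi>}"
  morphisms dual_apply Abs_strong_dual
  by (rule exI[of _ "\<lambda>_. 0"]) (simp add: linear_zero)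

setup_lifting type_definition_strong_dual

instantiation strong_dual :: (real_tvs) real_vector
begin

lift_definition zero_strong_dual :: "'a strong_dual" is "\<lambda>_. 0"
  by (simp add: linear_zero)
lift_definition plus_strong_dual :: "'a strong_dual \<Rightarrow> 'a strong_dual \<Rightarrow> 'a strong_dual"
  is "\<lambda>\<phi> \<psi> f. \<phi> f + \<psi> f" by (simp add: linear_compose_add continuous_on_add)
lift_definition minus_strong_dual :: "'a strong_dual \<Rightarrow> 'a strong_dual \<Rightarrow> 'a strong_dual"
  is "\<lambda>\<phi> \<psi> f. \<phi> f - \<psi> f" by (simp add: linear_compose_sub continuous_on_diff)
lift_definition uminus_strong_dual :: "'a strong_dual \<Rightarrow> 'a strong_dual"
  is "\<lambda>\<phi> f. - \<phi> f" by (simp add: linear_compose_neg continuous_on_minus)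
lift_definition scaleR_strong_dual :: "real \<Rightarrow> 'a strong_dual \<Rightarrow> 'a strong_dual"
  is "\<lambda>c \<phi> f. c * \<phi> f"
  using linear_compose_scale_right[where 'b = real] by (auto intro: continuous_on_mult_left)

instance
  by standard (transfer; simp add: algebra_simps)+

end

text \<open>The strong topology: uniform convergence on (von Neumann) bounded sets.\<close>

definition dual_nhd :: "'a::real_tvs set \<Rightarrow> real \<Rightarrow> 'a strong_dual \<Rightarrow> 'a strong_dual set"
  where "dual_nhd B \<epsilon> \<gamma> = {\<eta>. \<forall>f\<in>B. \<bar>dual_apply \<eta> f - dual_apply \<gamma> f\<bar> < \<epsilon>}"

instantiation strong_dual :: (real_tvs) t2_space
begin

definition open_strong_dual :: "'a strong_dual set \<Rightarrow> bool"
  where "open_strong_dual W \<longleftrightarrow>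
    (\<forall>\<gamma>\<in>W. \<exists>B \<epsilon>. tvs_bounded B \<and> \<epsilon> > 0 \<and> dual_nhd B \<epsilon> \<gamma> \<subseteq> W)"

instance
proof
  show "open (UNIV :: 'a strong_dual set)"
    unfolding open_strong_dual_def using tvs_bounded_empty zero_less_one by blast
next
  fix S T :: "'a strong_dual set"
  assume ST: "open S" "open T"
  show "open (S \<inter> T)"
    unfolding open_strong_dual_def
  proof
    fix \<gamma> assume "\<gamma> \<in> S \<inter> T"
    with ST obtain A \<epsilon> B \<delta> where *: "tvs_bounded A" "\<epsilon> > 0" "dual_nhd A \<epsilon> \<gamma> \<subseteq> S"
      "tvs_bounded B" "\<delta> > 0" "dual_nhd B \<delta> \<gamma> \<subseteq> T"
      unfolding open_strong_dual_def by (meson IntD1 IntD2)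
    have "dual_nhd (A \<union> B) (min \<epsilon> \<delta>) \<gamma> \<subseteq> dual_nhd A \<epsilon> \<gamma> \<inter> dual_nhd B \<delta> \<gamma>"
      unfolding dual_nhd_def by auto
    with * show "\<exists>B \<epsilon>. tvs_bounded B \<and> \<epsilon> > 0 \<and> dual_nhd B \<epsilon> \<gamma> \<subseteq> S \<inter> T"
      by (intro exI[of _ "A \<union> B"] exI[of _ "min \<epsilon> \<delta>"]) (auto intro: tvs_bounded_Un)
  qed
next
  fix \<U> :: "'a strong_dual set set"
  assume "\<forall>S\<in>\<U>. open S"
  then show "open (\<Union>\<U>)"
    unfolding open_strong_dual_def
  proof (intro ballI)
    fix \<gamma> assume *: "\<forall>S\<in>\<U>. \<forall>\<gamma>\<in>S. \<exists>B \<epsilon>. tvs_bounded B \<and> \<epsilon> > 0 \<and> dual_nhd B \<epsilon> \<gamma> \<subseteq> S" "\<gamma> \<in> \<Union>\<U>"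
    from *(2) obtain S where "S \<in> \<U>" "\<gamma> \<in> S" by (rule UnionE)
    from *(1)[rule_format, OF this] obtain B \<epsilon>
      where B: "tvs_bounded B" "\<epsilon> > 0" "dual_nhd B \<epsilon> \<gamma> \<subseteq> S" by meson
    show "\<exists>B \<epsilon>. tvs_bounded B \<and> \<epsilon> > 0 \<and> dual_nhd B \<epsilon> \<gamma> \<subseteq> \<Union>\<U>"
      using B(1,2) order_trans[OF B(3) Union_upper[OF \<open>S \<in> \<U>\<close>]]
      by (intro exI[of _ B] exI[of _ \<epsilon>]) simp
  qed
next
  fix \<gamma> \<eta> :: "'a strong_dual"
  assume "\<gamma> \<noteq> \<eta>"
  then obtain f where f: "dual_apply \<gamma> f \<noteq> dual_apply \<eta> f"
    by (metis dual_apply_inject ext)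
  define \<epsilon> where "\<epsilon> = \<bar>dual_apply \<gamma> f - dual_apply \<eta> f\<bar> / 2"
  have \<epsilon>: "\<epsilon> > 0" using f by (simp add: \<epsilon>_def)
  have op: "open {\<xi>. \<bar>dual_apply \<xi> f - c\<bar> < \<epsilon>}" for c
    unfolding open_strong_dual_def
  proof
    fix \<xi> assume "\<xi> \<in> {\<xi>. \<bar>dual_apply \<xi> f - c\<bar> < \<epsilon>}"
    then have pos: "\<epsilon> - \<bar>dual_apply \<xi> f - c\<bar> > 0" by simp
    have "dual_nhd {f} (\<epsilon> - \<bar>dual_apply \<xi> f - c\<bar>) \<xi> \<subseteq> {\<xi>. \<bar>dual_apply \<xi> f - c\<bar> < \<epsilon>}"
      unfolding dual_nhd_def by auto
    with pos tvs_bounded_singleton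
    show "\<exists>B \<delta>. tvs_bounded B \<and> \<delta> > 0 \<and> dual_nhd B \<delta> \<xi> \<subseteq> {\<xi>. \<bar>dual_apply \<xi> f - c\<bar> < \<epsilon>}"
      by blast
  qed
  show "\<exists>U V. open U \<and> open V \<and> \<gamma> \<in> U \<and> \<eta> \<in> V \<and> U \<inter> V = {}"
    by (rule exI[of _ "{\<xi>. \<bar>dual_apply \<xi> f - dual_apply \<gamma> f\<bar> < \<epsilon>}"],
        rule exI[of _ "{\<xi>. \<bar>dual_apply \<xi> f - dual_apply \<eta> f\<bar> < \<epsilon>}"])
       (use op \<epsilon> in \<open>auto simp: \<epsilon>_def abs_if split: if_splits\<close>)
qed

end

lemma dual_nhdD: "\<eta> \<in> dual_nhd B \<epsilon> \<gamma> \<Longrightarrow> f \<in> B \<Longrightarrow> \<bar>dual_apply \<eta> f - dual_apply \<gamma> f\<bar> < \<epsilon>"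
  unfolding dual_nhd_def by blast

lemma eventually_nhds_strong_dual:
  "eventually P (nhds \<gamma>) \<longleftrightarrow>
    (\<exists>B \<epsilon>. tvs_bounded B \<and> \<epsilon> > 0 \<and> (\<forall>\<eta>\<in>dual_nhd B \<epsilon> \<gamma>. P \<eta>))"
proof
  assume "eventually P (nhds \<gamma>)"
  then obtain U where U: "open U" "\<gamma> \<in> U" "\<And>\<eta>. \<eta> \<in> U \<Longrightarrow> P \<eta>"
    unfolding eventually_nhds by blast
  from U(1,2) obtain B \<epsilon> where B: "tvs_bounded B" "\<epsilon> > 0" "dual_nhd B \<epsilon> \<gamma> \<subseteq> U"
    unfolding open_strong_dual_def by meson
  show "\<exists>B \<epsilon>. tvs_bounded B \<and> \<epsilon> > 0 \<and> (\<forall>\<eta>\<in>dual_nhd B \<epsilon> \<gamma>. P \<eta>)"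
    using B(1,2) U(3)[OF subsetD[OF B(3)]] by (intro exI[of _ B] exI[of _ \<epsilon>]) simp
next
  assume "\<exists>B \<epsilon>. tvs_bounded B \<and> \<epsilon> > 0 \<and> (\<forall>\<eta>\<in>dual_nhd B \<epsilon> \<gamma>. P \<eta>)"
  then obtain B \<epsilon> where *: "tvs_bounded B" "\<epsilon> > 0" "\<forall>\<eta>\<in>dual_nhd B \<epsilon> \<gamma>. P \<eta>"
    by meson
  define Q where "Q \<delta> \<eta> \<longleftrightarrow> (\<forall>f\<in>B. \<bar>dual_apply \<eta> f - dual_apply \<gamma> f\<bar> \<le> \<delta>)" for \<delta> \<eta>
  define U where "U = {\<eta>. \<exists>\<delta>>0. \<delta> < \<epsilon> \<and> Q \<delta> \<eta>}"
  have "open U"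
    unfolding open_strong_dual_def
  proof
    fix \<eta> assume "\<eta> \<in> U"
    then obtain \<delta> where \<delta>: "0 < \<delta>" "\<delta> < \<epsilon>" and \<eta>: "Q \<delta> \<eta>"
      unfolding U_def by auto
    have "dual_nhd B ((\<epsilon> - \<delta>) / 2) \<eta> \<subseteq> U"
    proof
      fix \<xi> assume \<xi>: "\<xi> \<in> dual_nhd B ((\<epsilon> - \<delta>) / 2) \<eta>"
      have "Q ((\<epsilon> + \<delta>) / 2) \<xi>"
        unfolding Q_def
      proof
        fix f assume f: "f \<in> B"
        have "\<bar>dual_apply \<eta> f - dual_apply \<gamma> f\<bar> \<le> \<delta>"
          using \<eta> f unfolding Q_def by simp
        with dual_nhdD[OF \<xi> f] show "\<bar>dual_apply \<xi> f - dual_apply \<gamma> f\<bar> \<le> (\<epsilon> + \<delta>) / 2"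
          unfolding diff_divide_distrib add_divide_distrib by linarith
      qed
      moreover have "0 < (\<epsilon> + \<delta>) / 2" "(\<epsilon> + \<delta>) / 2 < \<epsilon>" using \<delta> by auto
      ultimately show "\<xi> \<in> U" unfolding U_def mem_Collect_eq by metis
    qed
    with *(1) \<delta> show "\<exists>B \<epsilon>. tvs_bounded B \<and> \<epsilon> > 0 \<and> dual_nhd B \<epsilon> \<eta> \<subseteq> U"
      by (intro exI[of _ B] exI[of _ "(\<epsilon> - \<delta>) / 2"]) simp
  qed
  moreover have "\<gamma> \<in> U"
    unfolding U_def Q_def using \<open>\<epsilon> > 0\<close> by (auto intro!: exI[of _ "\<epsilon> / 2"])
  moreover have "P \<eta>" if "\<eta> \<in> U" for \<eta>
  proof (rule *(3)[rule_format])
    from that obtain \<delta> where \<delta>: "\<delta> < \<epsilon>" "Q \<delta> \<eta>"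
      unfolding U_def by auto
    show "\<eta> \<in> dual_nhd B \<epsilon> \<gamma>"
      unfolding dual_nhd_def
    proof (intro CollectI ballI)
      fix f assume "f \<in> B"
      with \<delta>(2) have "\<bar>dual_apply \<eta> f - dual_apply \<gamma> f\<bar> \<le> \<delta>"
        unfolding Q_def by simp
      with \<delta>(1) show "\<bar>dual_apply \<eta> f - dual_apply \<gamma> f\<bar> < \<epsilon>" by linarith
    qed
  qed
  ultimately show "eventually P (nhds \<gamma>)"
    unfolding eventually_nhds by metis
qed

lemma dual_apply_bounded:
  assumes "tvs_bounded B"
  shows "\<exists>C\<ge>0. \<forall>f\<in>B. \<bar>dual_apply \<gamma> f\<bar> \<le> C"
proof -
  have lin: "linear (dual_apply \<gamma>)" and cont: "continuous_on UNIV (dual_apply \<gamma>)"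
    using dual_apply[of \<gamma>] by simp_all
  have "open (dual_apply \<gamma> -` {-1<..<1})"
    using cont by (intro open_vimage) auto
  moreover have "0 \<in> dual_apply \<gamma> -` {-1<..<1}"
    using linear_0[OF lin] by simp
  ultimately obtain r where r: "r > 0" "\<forall>t\<ge>r. B \<subseteq> (\<lambda>u. t *\<^sub>R u) ` (dual_apply \<gamma> -` {-1<..<1})"
    using assms unfolding tvs_bounded_def by meson
  have "\<bar>dual_apply \<gamma> f\<bar> \<le> r" if f: "f \<in> B" for f
  proof -
    have "B \<subseteq> (\<lambda>u. r *\<^sub>R u) ` (dual_apply \<gamma> -` {-1<..<1})"
      using r(2) by simp
    from subsetD[OF this f] obtain u where u: "f = r *\<^sub>R u" "u \<in> dual_apply \<gamma> -` {-1<..<1}"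
      by (rule imageE)
    then have "\<bar>dual_apply \<gamma> f\<bar> = r * \<bar>dual_apply \<gamma> u\<bar>"
      using r(1) by (simp add: linear_scale[OF lin] abs_mult)
    also have "\<dots> \<le> r * 1"
      using u(2) r(1) by (intro mult_left_mono) auto
    finally show ?thesis by simp
  qed
  with r(1) show ?thesis by (intro exI[of _ r]) simp
qed

instance strong_dual :: (real_tvs) real_tvs
proof
  fix a b :: "'a strong_dual"
  show "LIM p (nhds a \<times>\<^sub>F nhds b). fst p + snd p :> nhds (a + b)"
    unfolding filterlim_iff
  proof (intro allI impI)
    fix P assume "eventually P (nhds (a + b))"
    then obtain B \<epsilon> where *: "tvs_bounded B" "\<epsilon> > 0" "\<forall>\<eta>\<in>dual_nhd B \<epsilon> (a + b). P \<eta>"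
      unfolding eventually_nhds_strong_dual by meson
    have "P (\<phi> + \<psi>)" if \<phi>: "\<phi> \<in> dual_nhd B (\<epsilon> / 2) a" and \<psi>: "\<psi> \<in> dual_nhd B (\<epsilon> / 2) b" for \<phi> \<psi>
    proof (rule *(3)[rule_format])
      show "\<phi> + \<psi> \<in> dual_nhd B \<epsilon> (a + b)"
        unfolding dual_nhd_def
      proof (intro CollectI ballI)
        fix f assume "f \<in> B"
        from dual_nhdD[OF \<phi> this] dual_nhdD[OF \<psi> this]
        show "\<bar>dual_apply (\<phi> + \<psi>) f - dual_apply (a + b) f\<bar> < \<epsilon>"
          unfolding plus_strong_dual.rep_eq by linarith
      qed
    qed
    moreover have "eventually (\<lambda>\<phi>. \<phi> \<in> dual_nhd B (\<epsilon> / 2) c) (nhds c)" for c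
      unfolding eventually_nhds_strong_dual using *(1) half_gt_zero[OF *(2)] by meson
    ultimately show "eventually (\<lambda>p. P (fst p + snd p)) (nhds a \<times>\<^sub>F nhds b)"
      unfolding eventually_prod_filter
      by (intro exI[of _ "\<lambda>\<phi>. \<phi> \<in> dual_nhd B (\<epsilon> / 2) a"]
          exI[of _ "\<lambda>\<psi>. \<psi> \<in> dual_nhd B (\<epsilon> / 2) b"]) simp
  qed
next
  fix c :: real and a :: "'a strong_dual"
  show "LIM p (nhds c \<times>\<^sub>F nhds a). fst p *\<^sub>R snd p :> nhds (c *\<^sub>R a)"
    unfolding filterlim_iff
  proof (intro allI impI)
    fix P assume "eventually P (nhds (c *\<^sub>R a))"
    then obtain B \<epsilon> where *: "tvs_bounded B" "\<epsilon> > 0" "\<forall>\<eta>\<in>dual_nhd B \<epsilon> (c *\<^sub>R a). P \<eta>"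
      unfolding eventually_nhds_strong_dual by meson
    obtain C where C: "C \<ge> 0" "\<forall>f\<in>B. \<bar>dual_apply a f\<bar> \<le> C"
      using dual_apply_bounded[OF *(1), of a] by meson
    define \<delta> where "\<delta> = \<epsilon> / (2 * (\<bar>c\<bar> + 1))"
    define \<eta> where "\<eta> = min 1 (\<epsilon> / (2 * (C + 1)))"
    have pos: "\<delta> > 0" "\<eta> > 0"
      using *(2) C(1) by (auto simp: \<delta>_def \<eta>_def)
    have "P (s *\<^sub>R \<phi>)" if s: "\<bar>s - c\<bar> < \<eta>" and \<phi>: "\<phi> \<in> dual_nhd B \<delta> a" for s \<phi>
    proof (rule *(3)[rule_format])
      show "s *\<^sub>R \<phi> \<in> dual_nhd B \<epsilon> (c *\<^sub>R a)"
        unfolding dual_nhd_def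
      proof (intro CollectI ballI)
        fix f assume f: "f \<in> B"
        have "\<bar>s * dual_apply \<phi> f - c * dual_apply a f\<bar> < \<epsilon>"
          using *(2) C(1) C(2)[rule_format, OF f] s dual_nhdD[OF \<phi> f]
          unfolding \<eta>_def \<delta>_def by (rule scale_estimate)
        then show "\<bar>dual_apply (s *\<^sub>R \<phi>) f - dual_apply (c *\<^sub>R a) f\<bar> < \<epsilon>"
          unfolding scaleR_strong_dual.rep_eq .
      qed
    qed
    moreover have "eventually (\<lambda>s. \<bar>s - c\<bar> < \<eta>) (nhds c)"
      using pos unfolding eventually_nhds_metric dist_real_def by auto
    moreover have "eventually (\<lambda>\<phi>. \<phi> \<in> dual_nhd B \<delta> a) (nhds a)"
      unfolding eventually_nhds_strong_dual using *(1) pos(1) by meson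
    ultimately show "eventually (\<lambda>p. P (fst p *\<^sub>R snd p)) (nhds c \<times>\<^sub>F nhds a)"
      unfolding eventually_prod_filter
      by (intro exI[of _ "\<lambda>s. \<bar>s - c\<bar> < \<eta>"] exI[of _ "\<lambda>\<phi>. \<phi> \<in> dual_nhd B \<delta> a"]) simp
  qed
qed

section \<open>Poisson structures and the empirical measure\<close>

type_synonym 'd phase = "(real^'d) \<times> (real^'d)"

definition grad_x :: "('d::finite phase \<Rightarrow> real) \<Rightarrow> 'd phase \<Rightarrow> real^'d"
  where "grad_x f z = (\<chi> j. gateaux_derivative f z (axis j 1, 0))"

definition grad_v :: "('d::finite phase \<Rightarrow> real) \<Rightarrow> 'd phase \<Rightarrow> real^'d"
  where "grad_v f z = (\<chi> j. gateaux_derivative f z (0, axis j 1))"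

lift_definition lie_bracket ::
    "'d::finite phase smooth_fun \<Rightarrow> 'd phase smooth_fun \<Rightarrow> 'd phase smooth_fun"
  is "\<lambda>f g z. grad_x f z \<bullet> grad_v g z - grad_v f z \<bullet> grad_x g z"
  unfolding grad_x_def grad_v_def inner_vec_def inner_real_def vec_lambda_beta
  by (intro gateaux_smooth_diff gateaux_smooth_sum gateaux_smooth_mult gateaux_smooth_derivative)

definition represents_derivative ::
    "('a::real_tvs strong_dual \<Rightarrow> real) \<Rightarrow> 'a strong_dual \<Rightarrow> 'a \<Rightarrow> bool"
  where "represents_derivative F \<gamma> f \<longleftrightarrow> (\<forall>\<eta>. gateaux_derivative F \<gamma> \<eta> = dual_apply \<eta> f)"

text \<open>For smooth \<open>F\<close> the derivative at \<open>\<gamma>\<close> is a continuous linear functional on the strong dual.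
  The description picks the element of the original space which represents it; it exists by
  reflexivity of the space of smooth functions.\<close>

definition functional_derivative ::
    "('a::real_tvs strong_dual \<Rightarrow> real) \<Rightarrow> 'a strong_dual \<Rightarrow> 'a"
  where "functional_derivative F \<gamma> = (THE f. represents_derivative F \<gamma> f)"

definition lie_poisson_bracket ::
    "('d::finite phase smooth_fun strong_dual \<Rightarrow> real) \<Rightarrow> ('d phase smooth_fun strong_dual \<Rightarrow> real) \<Rightarrow>
      'd phase smooth_fun strong_dual \<Rightarrow> real"
  where "lie_poisson_bracket F G \<gamma> =
    dual_apply \<gamma> (lie_bracket (functional_derivative F \<gamma>) (functional_derivative G \<gamma>))"

definition partial_grad_x ::
    "'n::finite \<Rightarrow> ('d::finite phase ^ 'n \<Rightarrow> real) \<Rightarrow> 'd phase ^ 'n \<Rightarrow> real^'d"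
  where "partial_grad_x i F z = (\<chi> j. gateaux_derivative F z (axis i (axis j 1, 0)))"

definition partial_grad_v ::
    "'n::finite \<Rightarrow> ('d::finite phase ^ 'n \<Rightarrow> real) \<Rightarrow> 'd phase ^ 'n \<Rightarrow> real^'d"
  where "partial_grad_v i F z = (\<chi> j. gateaux_derivative F z (axis i (0, axis j 1)))"

definition particle_bracket ::
    "('d::finite phase ^ 'n::finite \<Rightarrow> real) \<Rightarrow> ('d phase ^ 'n \<Rightarrow> real) \<Rightarrow> 'd phase ^ 'n \<Rightarrow> real"
  where "particle_bracket F G z = real CARD('n) *
    (\<Sum>i\<in>UNIV. partial_grad_x i F z \<bullet> partial_grad_v i G z - partial_grad_v i F z \<bullet> partial_grad_x i G z)"

lemma continuous_on_smooth_apply: "continuous_on UNIV (\<lambda>f. smooth_apply f z)"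
  unfolding continuous_on_def
proof
  fix f :: "'a smooth_fun"
  show "((\<lambda>f. smooth_apply f z) \<longlongrightarrow> smooth_apply f z) (at f within UNIV)"
  proof (rule tendstoI)
    fix \<epsilon> :: real assume "\<epsilon> > 0"
    have "dist (smooth_apply g z) (smooth_apply f z) < \<epsilon>" if "g \<in> smooth_nhd {z} 0 \<epsilon> f" for g
    proof -
      obtain b :: 'a where "b \<in> Basis" using nonempty_Basis by blast
      then show ?thesis
        using smooth_nhdD[OF that order_refl singletonI, of "\<lambda>_. b"] by (auto simp: dist_real_def)
    qed
    then have "eventually (\<lambda>g. dist (smooth_apply g z) (smooth_apply f z) < \<epsilon>) (nhds f)"
      unfolding eventually_nhds_smooth_fun using \<open>\<epsilon> > 0\<close>
      by (intro exI[of _ "{z}"] exI[of _ 0] exI[of _ \<epsilon>]) simp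
    then show "eventually (\<lambda>g. dist (smooth_apply g z) (smooth_apply f z) < \<epsilon>) (at f within UNIV)"
      unfolding eventually_at_filter by (rule eventually_mono) simp
  qed
qed

lift_definition dirac :: "'a::euclidean_space \<Rightarrow> 'a smooth_fun strong_dual"
  is "\<lambda>z f. smooth_apply f z"
  by (auto simp: continuous_on_smooth_apply smooth_apply_add smooth_apply_scaleR intro!: linearI)

definition empirical_measure :: "'d::finite phase ^ 'n::finite \<Rightarrow> 'd phase smooth_fun strong_dual"
  where "empirical_measure z = (1 / real CARD('n)) *\<^sub>R (\<Sum>i\<in>UNIV. dirac (z $ i))"

end

theory Submission
  imports Defs
begin

text \<open>The derivative of \<open>dirac\<close> at \<open>x\<close> in direction \<open>k\<close> is a combination of adjoints of partial
  derivatives applied to \<open>dirac x\<close>, with coefficients linear in \<open>k\<close>; bounded sets of smooth functions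
  have uniformly bounded derivatives on compact sets, which makes the difference quotients and all
  higher derivatives converge in the strong dual. The chain rule then gives the derivative of
  \<open>F \<circ> \<iota>\<close> in the \<open>i\<close>-th particle as \<open>1 / N\<close> times that of the functional derivative of \<open>F\<close> at \<open>z\<^sub>i\<close>,
  and one of the two factors \<open>1 / N\<close> in the bracket cancels against \<open>N\<close>. The functional derivative
  exists by reflexivity, whose proof replaces Hahn-Banach by minimising a sum of squares over a
  bounded convex set.\<close>

section \<open>Calculus of Gateaux derivatives\<close>

lemma has_gateaux_derivative_linear_compose:
  fixes A :: "'b::{real_tvs, t2_space} \<Rightarrow> 'c::{real_vector, t2_space}"
  assumes "linear A" "continuous_on UNIV A" "has_gateaux_derivative f l x h"
  shows "has_gateaux_derivative (\<lambda>y. A (f y)) (A l) x h"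
proof -
  have "((\<lambda>t. A ((f (x + t *\<^sub>R h) - f x) /\<^sub>R t)) \<longlongrightarrow> A l) (at 0)"
    using assms(2,3) unfolding has_gateaux_derivative_def
    by (auto intro: continuous_on_tendsto_compose)
  then show ?thesis
    unfolding has_gateaux_derivative_def
    by (simp add: linear_scale[OF assms(1)] linear_diff[OF assms(1)])
qed

lemma has_gateaux_derivative_compose_linear:
  fixes A :: "'a::real_tvs \<Rightarrow> 'b::real_tvs"
  assumes "linear A" "has_gateaux_derivative f l (A x) (A h)"
  shows "has_gateaux_derivative (\<lambda>y. f (A y)) l x h"
  using assms unfolding has_gateaux_derivative_def
  by (simp add: linear_add linear_scale)

lemma has_gateaux_derivative_add:
  fixes f g :: "'a::real_tvs \<Rightarrow> 'b::{real_tvs, t2_space}"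
  assumes "has_gateaux_derivative f l x h" "has_gateaux_derivative g m x h"
  shows "has_gateaux_derivative (\<lambda>y. f y + g y) (l + m) x h"
proof -
  have "((\<lambda>t. (f (x + t *\<^sub>R h) - f x) /\<^sub>R t + (g (x + t *\<^sub>R h) - g x) /\<^sub>R t) \<longlongrightarrow> l + m) (at 0)"
    using assms unfolding has_gateaux_derivative_def by (rule tendsto_add)
  then show ?thesis
    unfolding has_gateaux_derivative_def by (simp add: algebra_simps)
qed

lemma has_gateaux_derivative_sum:
  fixes f :: "'i \<Rightarrow> 'a::real_tvs \<Rightarrow> 'b::{real_tvs, t2_space}"
  assumes "\<And>i. i \<in> I \<Longrightarrow> has_gateaux_derivative (f i) (l i) x h"
  shows "has_gateaux_derivative (\<lambda>y. \<Sum>i\<in>I. f i y) (\<Sum>i\<in>I. l i) x h"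
  using assms
proof (induction I rule: infinite_finite_induct)
  case (insert i I)
  then show ?case by (simp add: has_gateaux_derivative_add)
qed (simp_all add: has_gateaux_derivative_def)

lemma linear_tvs_scaleR: "linear (\<lambda>x::'a::real_vector. c *\<^sub>R x)"
  by (rule linearI) (simp_all add: algebra_simps)

lemma continuous_on_tvs_scaleR:
  fixes g :: "'b::topological_space \<Rightarrow> 'a::real_tvs"
  assumes "continuous_on S c" "continuous_on S g"
  shows "continuous_on S (\<lambda>x. c x *\<^sub>R g x)"
  using assms unfolding continuous_on_def by (auto intro: tendsto_scaleR_tvs)

lemma continuous_on_sum_tvs:
  fixes f :: "'i \<Rightarrow> 'b::topological_space \<Rightarrow> 'a::real_tvs"
  assumes "\<And>i. i \<in> I \<Longrightarrow> continuous_on S (f i)"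
  shows "continuous_on S (\<lambda>x. \<Sum>i\<in>I. f i x)"
  using assms
  by (induction I rule: infinite_finite_induct) (auto intro: continuous_on_add)

lemma gateaux_smooth_linear_compose:
  fixes A :: "'b::{real_tvs, t2_space} \<Rightarrow> 'c::{real_vector, t2_space}"
  assumes A: "linear A" "continuous_on UNIV A" and f: "gateaux_smooth f"
  shows "gateaux_smooth (\<lambda>x. A (f x))"
    and "iterated_derivative (\<lambda>x. A (f x)) n x h = A (iterated_derivative f n x h)"
proof -
  note d = has_gateaux_derivative_linear_compose[OF A gateaux_smooth_iterated'[OF f]]
  show "iterated_derivative (\<lambda>x. A (f x)) n x h = A (iterated_derivative f n x h)"
    using iterated_derivative_eqI[of "\<lambda>n x h. A (iterated_derivative f n x h)", OF _ d] by simp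
  show "gateaux_smooth (\<lambda>x. A (f x))"
    by (rule gateaux_smoothI[OF _ d])
      (use continuous_on_compose2[OF A(2) gateaux_smooth_continuous[OF f]] in
        \<open>auto simp: case_prod_unfold\<close>)
qed

text \<open>Each iterated derivative is that of f at \<open>A x\<close>, with all directions pushed
  forward by A.\<close>

lemma gateaux_smooth_compose_linear:
  fixes A :: "'a::real_tvs \<Rightarrow> 'b::real_tvs"
  assumes A: "linear A" "continuous_on UNIV A" and f: "gateaux_smooth f"
  shows "gateaux_smooth (\<lambda>x. f (A x))"
proof (rule gateaux_smoothI)
  let ?D = "\<lambda>n x h. iterated_derivative f n (A x) (A \<circ> h)"
  show "?D 0 x h = f (A x)" for x h by simp
  show "has_gateaux_derivative (\<lambda>y. ?D n y h) (?D (Suc n) x h) x (h n)" for n x h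
    by (rule has_gateaux_derivative_compose_linear[OF A(1), of "\<lambda>y. iterated_derivative f n y (A \<circ> h)"])
      (use gateaux_smooth_iterated'[OF f, of n "A \<circ> h" "A x"] in simp)
  have "continuous_on UNIV (\<lambda>p::'a \<times> (nat \<Rightarrow> 'a). (A (fst p), A \<circ> snd p))"
    unfolding o_def
    by (intro continuous_on_Pair continuous_on_coordinatewise_then_product
        continuous_on_compose2[OF A(2)] continuous_on_fst continuous_on_id
        continuous_on_product_then_coordinatewise[OF continuous_on_snd[OF continuous_on_id]]) auto
  from continuous_on_compose2[OF gateaux_smooth_continuous[OF f] this]
  show "continuous_on UNIV (\<lambda>(x, h). ?D n x h)" for n
    by (simp add: case_prod_unfold)
qed

lemma gateaux_smooth_sum_tvs:
  fixes f :: "'i \<Rightarrow> 'a::real_tvs \<Rightarrow> 'b::{real_tvs, t2_space}"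
  assumes "\<And>i. i \<in> I \<Longrightarrow> gateaux_smooth (f i)"
  shows "gateaux_smooth (\<lambda>x. \<Sum>i\<in>I. f i x)"
proof (rule gateaux_smoothI)
  let ?D = "\<lambda>n x h. \<Sum>i\<in>I. iterated_derivative (f i) n x h"
  show "has_gateaux_derivative (\<lambda>y. ?D n y h) (?D (Suc n) x h) x (h n)" for n x h
    using assms by (intro has_gateaux_derivative_sum gateaux_smooth_iterated')
  show "continuous_on UNIV (\<lambda>(x, h). ?D n x h)" for n
    using continuous_on_sum_tvs[OF gateaux_smooth_continuous[OF assms]]
    by (simp add: case_prod_unfold)
qed simp

section \<open>First derivatives: joint continuity, mean values, chain rule, linearity in the
  direction\<close>

lemma gateaux_smooth_has_gateaux_derivative:
  "gateaux_smooth f \<Longrightarrow> has_gateaux_derivative f (gateaux_derivative f x k) x k"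
  using gateaux_smooth_iterated'[of f 0 "\<lambda>_. k" x] by simp

lemma tendsto_gateaux_derivative:
  fixes f :: "'a::real_tvs \<Rightarrow> 'b::{real_vector, t2_space}"
  assumes f: "gateaux_smooth f" and "(u \<longlongrightarrow> x) F" "(w \<longlongrightarrow> k) F"
  shows "((\<lambda>t. gateaux_derivative f (u t) (w t)) \<longlongrightarrow> gateaux_derivative f x k) F"
proof -
  \<comment> \<open>A single direction is embedded as a constant sequence, so that joint continuity
    of the first iterated derivative becomes joint continuity in point and direction.\<close>
  have "continuous_on UNIV (\<lambda>p::'a \<times> 'a. (fst p, \<lambda>_::nat. snd p))"
    by (intro continuous_on_Pair continuous_on_fst continuous_on_snd continuous_on_id
        continuous_on_coordinatewise_then_product)
  from continuous_on_compose2[OF gateaux_smooth_continuous[OF f, of 1] this]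
  have "continuous_on UNIV (\<lambda>p. gateaux_derivative f (fst p) (snd p))" by simp
  from continuous_on_tendsto_compose[OF this tendsto_Pair[OF assms(2,3)]] show ?thesis by simp
qed

text \<open>Restriction to the line through x along k gives the one-variable mean value theorem. The
  bound \<bar>s\<bar> \<le> \<bar>t\<bar> covers both signs of t and t = 0, and it forces s to 0
  together with t.\<close>

lemma gateaux_smooth_mvt:
  fixes f :: "'a::real_tvs \<Rightarrow> real"
  assumes f: "gateaux_smooth f"
  shows "\<exists>s. \<bar>s\<bar> \<le> \<bar>t\<bar> \<and> f (x + t *\<^sub>R k) - f x = t * gateaux_derivative f (x + s *\<^sub>R k) k"
proof -
  let ?g = "\<lambda>s. f (x + s *\<^sub>R k)"
  have g: "(?g has_real_derivative gateaux_derivative f (x + s *\<^sub>R k) k) (at s)" for s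
    using gateaux_smooth_has_gateaux_derivative[OF f, of "x + s *\<^sub>R k" k]
      DERIV_shift[of ?g _ 0 s]
    unfolding has_gateaux_derivative_real_iff by (simp add: algebra_simps)
  consider "t = 0" | "t > 0" | "t < 0" by linarith
  then show ?thesis
  proof cases
    case 2
    from MVT2[OF this g] obtain s where "0 < s" "s < t"
      "?g t - ?g 0 = (t - 0) * gateaux_derivative f (x + s *\<^sub>R k) k" by blast
    then show ?thesis by (intro exI[of _ s]) simp
  next
    case 3
    from MVT2[OF this g] obtain s where "t < s" "s < 0"
      "?g 0 - ?g t = (0 - t) * gateaux_derivative f (x + s *\<^sub>R k) k" by blast
    then show ?thesis by (intro exI[of _ s]) simp
  qed simp
qed

text \<open>The increment of g is t times its difference quotient \<open>w t\<close>. The mean value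
  theorem is applied to f along this moving direction, and joint continuity of the derivative of f
  gives the limit.\<close>

lemma has_gateaux_derivative_chain:
  fixes f :: "'b::{real_tvs, t2_space} \<Rightarrow> real" and g :: "'a::real_tvs \<Rightarrow> 'b"
  assumes f: "gateaux_smooth f" and g: "has_gateaux_derivative g l z k"
  shows "has_gateaux_derivative (\<lambda>y. f (g y)) (gateaux_derivative f (g z) l) z k"
proof -
  define w where "w t = (g (z + t *\<^sub>R k) - g z) /\<^sub>R t" for t
  have "\<exists>s. \<forall>t. \<bar>s t\<bar> \<le> \<bar>t\<bar> \<and>
      f (g z + t *\<^sub>R w t) - f (g z) = t * gateaux_derivative f (g z + s t *\<^sub>R w t) (w t)"
    by (intro choice allI gateaux_smooth_mvt[OF f])
  then obtain s where s: "\<And>t. \<bar>s t\<bar> \<le> \<bar>t\<bar>"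
    "\<And>t. f (g z + t *\<^sub>R w t) - f (g z) = t * gateaux_derivative f (g z + s t *\<^sub>R w t) (w t)"
    by blast
  have w: "(w \<longlongrightarrow> l) (at 0)"
    using g unfolding has_gateaux_derivative_def w_def .
  have "(s \<longlongrightarrow> 0) (at 0)"
    by (rule Lim_null_comparison[of _ "\<lambda>t. \<bar>t\<bar>"])
      (use s(1) in \<open>auto intro!: always_eventually tendsto_eq_intros\<close>)
  then have "((\<lambda>t. g z + s t *\<^sub>R w t) \<longlongrightarrow> g z + 0 *\<^sub>R l) (at 0)"
    by (intro tendsto_add tendsto_const tendsto_scaleR_tvs w)
  then have lim: "((\<lambda>t. gateaux_derivative f (g z + s t *\<^sub>R w t) (w t)) \<longlongrightarrow> gateaux_derivative f (g z) l) (at 0)"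
    by (intro tendsto_gateaux_derivative[OF f] w) simp
  have eq: "gateaux_derivative f (g z + s t *\<^sub>R w t) (w t) = (f (g (z + t *\<^sub>R k)) - f (g z)) /\<^sub>R t"
    if "t \<noteq> 0" for t
    using s(2)[of t] that by (simp add: w_def divide_inverse_commute[symmetric] field_simps)
  show ?thesis
    unfolding has_gateaux_derivative_def
    by (rule Lim_transform_eventually[OF lim], unfold eventually_at_filter)
      (rule always_eventually, use eq in blast)
qed

text \<open>Homogeneity is a reparametrisation of the line. For additivity the step along h + k is
  split into one along h followed by one along k; the mean value theorem handles the second, whose
  base point tends to x.\<close>

lemma linear_gateaux_derivative:
  fixes f :: "'a::real_tvs \<Rightarrow> real"
  assumes f: "gateaux_smooth f"
  shows "linear (gateaux_derivative f x)"
proof (rule linearI)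
  show "gateaux_derivative f x (c *\<^sub>R k) = c *\<^sub>R gateaux_derivative f x k" for c k
  proof (rule gateaux_derivative_eqI)
    \<comment> \<open>The point 0 is written \<open>0 * c\<close> to match the value of the inner
      function t * c in the one-variable chain rule.\<close>
    have "((\<lambda>t. f (x + t *\<^sub>R k)) has_real_derivative gateaux_derivative f x k) (at (0 * c))"
      using gateaux_smooth_has_gateaux_derivative[OF f, of x k]
      unfolding has_gateaux_derivative_real_iff by simp
    moreover have "((\<lambda>t. t * c) has_real_derivative c) (at 0)"
      by (auto intro!: derivative_eq_intros)
    ultimately show "has_gateaux_derivative f (c *\<^sub>R gateaux_derivative f x k) x (c *\<^sub>R k)"
      unfolding has_gateaux_derivative_real_iff
      using DERIV_chain2[of "\<lambda>t. f (x + t *\<^sub>R k)" "gateaux_derivative f x k" "\<lambda>t. t * c" 0 c UNIV]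
      by (simp add: mult.commute)
  qed
next
  fix h k
  have "\<exists>s. \<forall>t. \<bar>s t\<bar> \<le> \<bar>t\<bar> \<and> f ((x + t *\<^sub>R h) + t *\<^sub>R k) - f (x + t *\<^sub>R h) =
      t * gateaux_derivative f ((x + t *\<^sub>R h) + s t *\<^sub>R k) k"
    by (intro choice allI gateaux_smooth_mvt[OF f])
  then obtain s where s: "\<And>t. \<bar>s t\<bar> \<le> \<bar>t\<bar>"
    "\<And>t. f ((x + t *\<^sub>R h) + t *\<^sub>R k) - f (x + t *\<^sub>R h) =
      t * gateaux_derivative f ((x + t *\<^sub>R h) + s t *\<^sub>R k) k"
    by blast
  have "(s \<longlongrightarrow> 0) (at 0)"
    by (rule Lim_null_comparison[of _ "\<lambda>t. \<bar>t\<bar>"])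
      (use s(1) in \<open>auto intro!: always_eventually tendsto_eq_intros\<close>)
  then have "((\<lambda>t. (x + t *\<^sub>R h) + s t *\<^sub>R k) \<longlongrightarrow> (x + 0 *\<^sub>R h) + 0 *\<^sub>R k) (at 0)"
    by (intro tendsto_add tendsto_const tendsto_scaleR_tvs tendsto_ident_at)
  then have lim: "((\<lambda>t. gateaux_derivative f ((x + t *\<^sub>R h) + s t *\<^sub>R k) k + (f (x + t *\<^sub>R h) - f x) /\<^sub>R t)
      \<longlongrightarrow> gateaux_derivative f x k + gateaux_derivative f x h) (at 0)"
    using gateaux_smooth_has_gateaux_derivative[OF f, of x h]
    unfolding has_gateaux_derivative_def
    by (intro tendsto_add tendsto_gateaux_derivative[OF f] tendsto_const) simp_all
  have eq: "gateaux_derivative f ((x + t *\<^sub>R h) + s t *\<^sub>R k) k + (f (x + t *\<^sub>R h) - f x) /\<^sub>R t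
      = (f (x + t *\<^sub>R (h + k)) - f x) /\<^sub>R t" if "t \<noteq> 0" for t
    using s(2)[of t] that by (simp add: field_simps scaleR_add_right add.assoc)
  have "has_gateaux_derivative f (gateaux_derivative f x k + gateaux_derivative f x h) x (h + k)"
    unfolding has_gateaux_derivative_def
    by (rule Lim_transform_eventually[OF lim], unfold eventually_at_filter)
      (rule always_eventually, use eq in blast)
  then show "gateaux_derivative f x (h + k) = gateaux_derivative f x h + gateaux_derivative f x k"
    by (simp add: gateaux_derivative_eqI add.commute)
qed

lemma continuous_on_gateaux_derivative:
  "gateaux_smooth f \<Longrightarrow> continuous_on UNIV (gateaux_derivative f x)"
  unfolding continuous_on_def by (auto intro: tendsto_gateaux_derivative)

section \<open>Basis expansions, Lipschitz bounds and the order of differentiation\<close>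

lemma gateaux_derivative_Basis:
  fixes f :: "'a::euclidean_space \<Rightarrow> real"
  assumes f: "gateaux_smooth f"
  shows "gateaux_derivative f x k = (\<Sum>b\<in>Basis. (k \<bullet> b) * gateaux_derivative f x b)"
proof -
  have "gateaux_derivative f x (\<Sum>b\<in>Basis. (k \<bullet> b) *\<^sub>R b) = (\<Sum>b\<in>Basis. (k \<bullet> b) * gateaux_derivative f x b)"
    by (simp add: linear_sum[OF linear_gateaux_derivative[OF f]]
        linear_scale[OF linear_gateaux_derivative[OF f]])
  then show ?thesis by (simp add: euclidean_representation)
qed

text \<open>The mean value theorem on the segment from x to y, with y - x expanded in the basis. The
  bound is assumed along basis directions because these are what \<open>smooth_nhd\<close> controls;
  the expansion costs the factor \<open>DIM('a)\<close>.\<close>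

lemma gateaux_smooth_lipschitz:
  fixes f :: "'a::euclidean_space \<Rightarrow> real"
  assumes f: "gateaux_smooth f" and K: "convex K" "x \<in> K" "y \<in> K"
    and C: "\<And>z b. z \<in> K \<Longrightarrow> b \<in> Basis \<Longrightarrow> \<bar>gateaux_derivative f z b\<bar> \<le> C"
  shows "\<bar>f y - f x\<bar> \<le> real DIM('a) * C * norm (y - x)"
proof -
  let ?l = "\<lambda>s. x + s *\<^sub>R (y - x)"
  have g: "((\<lambda>s. f (?l s)) has_real_derivative gateaux_derivative f (?l s) (y - x)) (at s)"
    for s
    using gateaux_smooth_has_gateaux_derivative[OF f, of "?l s" "y - x"]
      DERIV_shift[of "\<lambda>s. f (?l s)" _ 0 s]
    unfolding has_gateaux_derivative_real_iff by (simp add: algebra_simps)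
  from MVT2[OF zero_less_one g]
  obtain s where s: "0 < s" "s < 1" "f (?l 1) - f (?l 0) = (1 - 0) * gateaux_derivative f (?l s) (y - x)"
    by blast
  have "?l s = (1 - s) *\<^sub>R x + s *\<^sub>R y" by (simp add: algebra_simps)
  then have "?l s \<in> K" using s(1,2) K by (simp add: convexD)
  have "\<bar>f y - f x\<bar> = \<bar>\<Sum>b\<in>Basis. ((y - x) \<bullet> b) * gateaux_derivative f (?l s) b\<bar>"
    using s(3) gateaux_derivative_Basis[OF f, of "?l s" "y - x"] by simp
  also have "\<dots> \<le> (\<Sum>b\<in>Basis. \<bar>(y - x) \<bullet> b\<bar> * \<bar>gateaux_derivative f (?l s) b\<bar>)"
    unfolding abs_mult[symmetric] by (rule sum_abs)
  also have "\<dots> \<le> (\<Sum>b\<in>(Basis::'a set). norm (y - x) * C)"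
    using C[OF \<open>?l s \<in> K\<close>] by (intro sum_mono mult_mono Basis_le_norm) auto
  finally show ?thesis by (simp add: mult_ac)
qed

text \<open>The derivative along e is taken first, so e becomes entry 0 of the direction sequence
  and the entries of h move up by one.\<close>

lemma iterated_derivative_gateaux_derivative:
  fixes f :: "'a::real_tvs \<Rightarrow> real"
  assumes "gateaux_smooth f"
  shows "iterated_derivative (\<lambda>x. gateaux_derivative f x e) n x h =
    iterated_derivative f (Suc n) x (case_nat e h)"
proof -
  have "iterated_derivative (\<lambda>x. gateaux_derivative f x e) =
      (\<lambda>n x h. iterated_derivative f (Suc n) x (case_nat e h))"
  proof (rule iterated_derivative_eqI)
    show "has_gateaux_derivative (\<lambda>y. iterated_derivative f (Suc n) y (case_nat e h))
        (iterated_derivative f (Suc (Suc n)) x (case_nat e h)) x (h n)" for n x h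
      using gateaux_smooth_iterated'[OF assms, of "Suc n" "case_nat e h" x] by simp
  qed simp
  then show ?thesis by simp
qed

lemma gateaux_smooth_iterated_derivative:
  fixes f :: "'a::real_tvs \<Rightarrow> real"
  shows "gateaux_smooth f \<Longrightarrow> gateaux_smooth (\<lambda>x. iterated_derivative f n x h)"
  by (induction n) (auto intro: gateaux_smooth_derivative)

text \<open>The n-th iterated derivative reads only the entries of h below n, so entry n is free to
  hold the new direction.\<close>

lemma gateaux_derivative_iterated:
  "gateaux_derivative (\<lambda>y. iterated_derivative f n y h) x k = iterated_derivative f (Suc n) x (h(n := k))"
proof -
  have "(\<lambda>y. iterated_derivative f n y (h(n := k))) = (\<lambda>y. iterated_derivative f n y h)"
    by (intro ext iterated_derivative_cong) simp
  then show ?thesis by simp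
qed

section \<open>Smoothness of the Dirac embedding\<close>

text \<open>Serves three purposes: n = 0 gives continuity of \<open>dirac\<close>, n = 1 its
  derivative, and general n the passage from a finite net to a compact set in the reflexivity
  proof.\<close>

lemma iterated_derivative_lipschitz:
  fixes f :: "'a::euclidean_space \<Rightarrow> real"
  assumes f: "gateaux_smooth f" and K: "convex K" "x \<in> K" "y \<in> K" and h: "range h \<subseteq> Basis"
    and C: "\<And>z h. z \<in> K \<Longrightarrow> range h \<subseteq> Basis \<Longrightarrow> \<bar>iterated_derivative f (Suc n) z h\<bar> \<le> C"
  shows "\<bar>iterated_derivative f n y h - iterated_derivative f n x h\<bar> \<le> real DIM('a) * C * norm (y - x)"
proof (rule gateaux_smooth_lipschitz[OF gateaux_smooth_iterated_derivative[OF f] K])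
  show "\<bar>gateaux_derivative (\<lambda>x. iterated_derivative f n x h) z b\<bar> \<le> C" if "z \<in> K" "b \<in> Basis" for z b
  proof -
    have "range (h(n := b)) \<subseteq> Basis"
      using h that(2) by auto
    then show ?thesis
      unfolding gateaux_derivative_iterated by (rule C[OF that(1)])
  qed
qed

lemma iterated_derivative_minus:
  fixes f g :: "'a::real_tvs \<Rightarrow> real"
  assumes "gateaux_smooth f" "gateaux_smooth g"
  shows "iterated_derivative (\<lambda>x. f x - g x) n x h = iterated_derivative f n x h - iterated_derivative g n x h"
  using iterated_derivative_add[OF assms(1) gateaux_smooth_uminus[OF assms(2)]]
    iterated_derivative_scale[OF assms(2), of "-1"] by simp

lemma smooth_apply_diff: "smooth_apply (f - g) = (\<lambda>x. smooth_apply f x - smooth_apply g x)"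
  by transfer simp

lemma smooth_apply_zero: "smooth_apply 0 = (\<lambda>_. 0)"
  by transfer simp

section \<open>Directional derivatives as operators on smooth functions\<close>

lift_definition directional_derivative :: "'a::euclidean_space \<Rightarrow> 'a smooth_fun \<Rightarrow> 'a smooth_fun"
  is "\<lambda>e f x. gateaux_derivative f x e"
  by (rule gateaux_smooth_derivative)

lemma linear_directional_derivative: "linear (directional_derivative e)"
proof (rule linearI)
  note d = gateaux_smooth_has_gateaux_derivative[OF gateaux_smooth_apply]
  show "directional_derivative e (f + g) = directional_derivative e f + directional_derivative e g" for f g
    unfolding smooth_apply_inject[symmetric] smooth_apply_add directional_derivative.rep_eq
    by (intro ext gateaux_derivative_eqI has_gateaux_derivative_add d)
  show "directional_derivative e (c *\<^sub>R f) = c *\<^sub>R directional_derivative e f" for c f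
    unfolding smooth_apply_inject[symmetric] smooth_apply_scaleR directional_derivative.rep_eq
    using has_gateaux_derivative_linear_compose[OF linear_tvs_scaleR[of c]
          continuous_on_tvs_scaleR[OF continuous_on_const continuous_on_id] d]
    by (intro ext gateaux_derivative_eqI) simp
qed

text \<open>One order is lost: closeness in m + 1 derivatives controls m derivatives of the image.
  With b in the basis, \<open>case_nat b h\<close> remains one of the sequences tested by
  \<open>smooth_nhd\<close>.\<close>

lemma continuous_directional_derivative:
  fixes b :: "'a::euclidean_space"
  assumes b: "b \<in> Basis"
  shows "continuous_on UNIV (directional_derivative b)"
proof -
  have "(directional_derivative b \<longlongrightarrow> directional_derivative b f) (nhds f)" for f
    unfolding filterlim_iff
  proof (intro allI impI)
    fix P assume "eventually P (nhds (directional_derivative b f))"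
    then obtain K m \<epsilon> where *: "compact K" "\<epsilon> > 0" "\<forall>g\<in>smooth_nhd K m \<epsilon> (directional_derivative b f). P g"
      unfolding eventually_nhds_smooth_fun by meson
    have "directional_derivative b g \<in> smooth_nhd K m \<epsilon> (directional_derivative b f)"
      if g: "g \<in> smooth_nhd K (Suc m) \<epsilon> f" for g
      unfolding smooth_nhd_def
    proof (intro CollectI allI impI ballI)
      fix n x and h :: "nat \<Rightarrow> 'a" assume nxh: "n \<le> m" "x \<in> K" "range h \<subseteq> Basis"
      have "range (case_nat b h) \<subseteq> Basis"
        using b nxh(3) by (auto simp: image_subset_iff split: nat.splits)
      with nxh show "\<bar>iterated_derivative (smooth_apply (directional_derivative b g)) n x h -
          iterated_derivative (smooth_apply (directional_derivative b f)) n x h\<bar> < \<epsilon>"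
        unfolding directional_derivative.rep_eq
          iterated_derivative_gateaux_derivative[OF gateaux_smooth_apply]
        by (intro smooth_nhdD[OF g]) auto
    qed
    with * show "\<forall>\<^sub>F g in nhds f. P (directional_derivative b g)"
      unfolding eventually_nhds_smooth_fun by blast
  qed
  then show ?thesis
    unfolding continuous_on_def using filterlim_mono[OF _ order_refl at_within_le_nhds] by blast
qed

section \<open>Bounded sets and convergence in the strong dual\<close>

lemma tvs_bounded_image:
  fixes A :: "'a::real_tvs \<Rightarrow> 'b::real_tvs"
  assumes "tvs_bounded B" "linear A" "continuous_on UNIV A"
  shows "tvs_bounded (A ` B)"
  unfolding tvs_bounded_def
proof (intro allI impI)
  fix U :: "'b set" assume U: "open U" "0 \<in> U"
  have "open (A -` U)" "0 \<in> A -` U"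
    using open_vimage[OF U(1) assms(3)] U(2) linear_0[OF assms(2)] by auto
  then obtain r where r: "r > 0" "\<forall>t\<ge>r. B \<subseteq> (\<lambda>u. t *\<^sub>R u) ` (A -` U)"
    using assms(1) unfolding tvs_bounded_def by meson
  have "A ` B \<subseteq> (\<lambda>u. t *\<^sub>R u) ` U" if "t \<ge> r" for t
  proof
    fix y assume "y \<in> A ` B"
    then obtain x where x: "x \<in> B" "y = A x" by blast
    then obtain u where "u \<in> A -` U" "x = t *\<^sub>R u"
      using r(2) \<open>t \<ge> r\<close> by blast
    with x show "y \<in> (\<lambda>u. t *\<^sub>R u) ` U"
      using linear_scale[OF assms(2)] by auto
  qed
  with r(1) show "\<exists>r>0. \<forall>t\<ge>r. A ` B \<subseteq> (\<lambda>u. t *\<^sub>R u) ` U" by blast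
qed

text \<open>A bounded set is absorbed by an open set inside \<open>smooth_nhd K m 1 0\<close>; the
  absorbing factor is the common bound.\<close>

lemma tvs_bounded_iterated_derivative:
  fixes B :: "'a::euclidean_space smooth_fun set"
  assumes "tvs_bounded B" "compact K"
  shows "\<exists>C\<ge>0. \<forall>f\<in>B. \<forall>n\<le>m. \<forall>x\<in>K. \<forall>h. range h \<subseteq> Basis \<longrightarrow>
    \<bar>iterated_derivative (smooth_apply f) n x h\<bar> \<le> C"
proof -
  have "eventually (\<lambda>g. g \<in> smooth_nhd K m 1 0) (nhds 0)"
    unfolding eventually_nhds_smooth_fun using assms(2) zero_less_one by blast
  then obtain U where U: "open U" "0 \<in> U" "\<And>g. g \<in> U \<Longrightarrow> g \<in> smooth_nhd K m 1 0"
    unfolding eventually_nhds by blast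
  then obtain r where r: "r > 0" "\<forall>t\<ge>r. B \<subseteq> (\<lambda>u. t *\<^sub>R u) ` U"
    using assms(1) unfolding tvs_bounded_def by meson
  have "\<bar>iterated_derivative (smooth_apply f) n x h\<bar> \<le> r"
    if "f \<in> B" and nxh: "n \<le> m" "x \<in> K" "range h \<subseteq> Basis" for f n x h
  proof -
    have "f \<in> (\<lambda>u. r *\<^sub>R u) ` U"
      using r(2) that(1) by blast
    then obtain u where u: "f = r *\<^sub>R u" "u \<in> U"
      by (rule imageE)
    have "\<bar>iterated_derivative (smooth_apply u) n x h\<bar> < 1"
      using smooth_nhdD[OF U(3)[OF u(2)] nxh]
      by (simp add: smooth_apply_zero iterated_derivative_const split: if_splits)
    then show ?thesis
      using r(1) by (simp add: u(1) smooth_apply_scaleR iterated_derivative_scale[OF gateaux_smooth_apply]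
          abs_mult mult_le_cancel_left1)
  qed
  with r(1) show ?thesis by (intro exI[of _ r]) auto
qed

lemma tendsto_strong_dualI:
  assumes "\<And>B \<epsilon>. tvs_bounded B \<Longrightarrow> \<epsilon> > 0 \<Longrightarrow>
    eventually (\<lambda>t. \<forall>f\<in>B. \<bar>dual_apply (g t) f - dual_apply l f\<bar> < \<epsilon>) F"
  shows "(g \<longlongrightarrow> l) F"
  unfolding filterlim_iff
proof (intro allI impI)
  fix P assume "eventually P (nhds l)"
  then obtain B \<epsilon> where *: "tvs_bounded B" "\<epsilon> > 0" "\<forall>\<eta>\<in>dual_nhd B \<epsilon> l. P \<eta>"
    unfolding eventually_nhds_strong_dual by meson
  from assms[OF *(1,2)] show "eventually (\<lambda>t. P (g t)) F"
    by (rule eventually_mono) (use *(3) in \<open>auto simp: dual_nhd_def\<close>)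
qed

section \<open>Pairings and transposes on the strong dual\<close>

lemma linear_dual_apply_left: "linear (\<lambda>\<eta>. dual_apply \<eta> f)"
  by (rule linearI) (simp_all add: plus_strong_dual.rep_eq scaleR_strong_dual.rep_eq)

lemma continuous_dual_apply_left: "continuous_on UNIV (\<lambda>\<eta>. dual_apply \<eta> f)"
proof -
  have "((\<lambda>\<eta>. dual_apply \<eta> f) \<longlongrightarrow> dual_apply \<gamma> f) (nhds \<gamma>)" for \<gamma>
  proof (rule tendstoI)
    fix \<epsilon> :: real assume "\<epsilon> > 0"
    then show "\<forall>\<^sub>F \<eta> in nhds \<gamma>. dist (dual_apply \<eta> f) (dual_apply \<gamma> f) < \<epsilon>"
      unfolding eventually_nhds_strong_dual
      by (intro exI[of _ "{f}"] exI[of _ \<epsilon>]) (auto simp: tvs_bounded_singleton dist_real_def dual_nhd_def)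
  qed
  then show ?thesis
    unfolding continuous_on_def using filterlim_mono[OF _ order_refl at_within_le_nhds] by blast
qed

lemmas dual_apply_sum = linear_sum[OF linear_dual_apply_left]
  and dual_apply_scaleR = scaleR_strong_dual.rep_eq
  and dual_apply_diff = minus_strong_dual.rep_eq

lemma linear_dual_apply: "linear (dual_apply \<eta>)"
  and continuous_dual_apply: "continuous_on UNIV (dual_apply \<eta>)"
  using dual_apply[of \<eta>] by auto

text \<open>The transpose of A. \<open>Abs_strong_dual\<close> is meaningful on continuous linear
  functionals, hence the assumptions on A in the context below.\<close>

definition dual_adjoint :: "('a::real_tvs \<Rightarrow> 'b::real_tvs) \<Rightarrow> 'b strong_dual \<Rightarrow> 'a strong_dual"
  where "dual_adjoint A \<eta> = Abs_strong_dual (\<lambda>f. dual_apply \<eta> (A f))"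

context
  fixes A :: "'a::real_tvs \<Rightarrow> 'b::real_tvs"
  assumes A: "linear A" "continuous_on UNIV A"
begin

lemma dual_apply_dual_adjoint: "dual_apply (dual_adjoint A \<eta>) f = dual_apply \<eta> (A f)"
  unfolding dual_adjoint_def
  using linear_compose[OF A(1) linear_dual_apply[of \<eta>]]
    continuous_on_compose2[OF continuous_dual_apply[of \<eta>] A(2)]
  by (subst Abs_strong_dual_inverse) (auto simp: o_def)

lemma linear_dual_adjoint: "linear (dual_adjoint A)"
  by (rule linearI)
    (auto simp: dual_apply_inject[symmetric] dual_apply_dual_adjoint plus_strong_dual.rep_eq dual_apply_scaleR)

text \<open>The basic neighbourhood given by a bounded set B pulls back to the one given by the
  image of B under A, which is again bounded.\<close>

lemma continuous_dual_adjoint: "continuous_on UNIV (dual_adjoint A)"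
proof -
  have "(dual_adjoint A \<longlongrightarrow> dual_adjoint A \<gamma>) (nhds \<gamma>)" for \<gamma>
  proof (rule tendsto_strong_dualI)
    fix B :: "'a set" and \<epsilon> :: real assume "tvs_bounded B" "\<epsilon> > 0"
    then show "\<forall>\<^sub>F \<eta> in nhds \<gamma>. \<forall>f\<in>B.
        \<bar>dual_apply (dual_adjoint A \<eta>) f - dual_apply (dual_adjoint A \<gamma>) f\<bar> < \<epsilon>"
      unfolding eventually_nhds_strong_dual dual_apply_dual_adjoint
      by (intro exI[of _ "A ` B"] exI[of _ \<epsilon>]) (auto simp: tvs_bounded_image A dual_nhd_def)
  qed
  then show ?thesis
    unfolding continuous_on_def using filterlim_mono[OF _ order_refl at_within_le_nhds] by blast
qed

end

section \<open>Continuity, differentiability and smoothness of the Dirac embedding\<close>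

lemma continuous_dirac: "continuous_on UNIV dirac"
proof -
  have "(dirac \<longlongrightarrow> dirac x) (nhds x)" for x :: 'a
  proof (rule tendsto_strong_dualI)
    fix B :: "'a smooth_fun set" and \<epsilon> :: real assume B: "tvs_bounded B" and \<epsilon>: "\<epsilon> > 0"
    \<comment> \<open>A common bound on the first derivatives over the unit ball gives all f in B
      the same Lipschitz constant M there.\<close>
    obtain C where C: "C \<ge> 0" "\<And>f n y h. f \<in> B \<Longrightarrow> n \<le> 1 \<Longrightarrow> y \<in> cball x 1 \<Longrightarrow> range h \<subseteq> Basis \<Longrightarrow>
        \<bar>iterated_derivative (smooth_apply f) n y h\<bar> \<le> C"
      using tvs_bounded_iterated_derivative[OF B compact_cball, of 1 x 1] by metis
    define M where "M = real DIM('a) * C"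
    have M: "M \<ge> 0" using C(1) by (simp add: M_def)
    have "\<bar>dual_apply (dirac y) f - dual_apply (dirac x) f\<bar> < \<epsilon>"
      if y: "dist y x < min 1 (\<epsilon> / (M + 1))" and f: "f \<in> B" for y f
    proof -
      obtain b :: 'a where b: "b \<in> Basis" using nonempty_Basis by blast
      have "y \<in> cball x 1" using y by (simp add: dist_commute)
      then have "\<bar>smooth_apply f y - smooth_apply f x\<bar> \<le> M * norm (y - x)"
        using iterated_derivative_lipschitz[OF gateaux_smooth_apply[of f], of "cball x 1" x y "\<lambda>_. b" 0 C]
          C(2)[OF f, of 1] b by (simp add: M_def image_subset_iff)
      also have "\<dots> \<le> (M + 1) * norm (y - x)" by (simp add: algebra_simps)
      also have "\<dots> < \<epsilon>" using y M by (simp add: dist_norm field_simps)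
      finally show ?thesis by (simp add: dirac.rep_eq)
    qed
    moreover have "min 1 (\<epsilon> / (M + 1)) > 0" using \<epsilon> M by simp
    ultimately show "\<forall>\<^sub>F y in nhds x. \<forall>f\<in>B. \<bar>dual_apply (dirac y) f - dual_apply (dirac x) f\<bar> < \<epsilon>"
      unfolding eventually_nhds_metric by blast
  qed
  then show ?thesis
    unfolding continuous_on_def using filterlim_mono[OF _ order_refl at_within_le_nhds] by blast
qed

text \<open>The limit functional sends f to its derivative at x along k, expanded in basis
  directions. Paired with f, the difference quotient is a derivative of f at an intermediate point,
  and a bound on second derivatives, uniform over a bounded set of f, makes the error
  O(\<bar>t\<bar>).\<close>

lemma has_gateaux_derivative_dirac:
  fixes x k :: "'a::euclidean_space"
  shows "has_gateaux_derivative dirac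
    (\<Sum>b\<in>Basis. (k \<bullet> b) *\<^sub>R dual_adjoint (directional_derivative b) (dirac x)) x k"
  unfolding has_gateaux_derivative_def
proof (rule tendsto_strong_dualI)
  fix B :: "'a smooth_fun set" and \<epsilon> :: real assume B: "tvs_bounded B" and \<epsilon>: "\<epsilon> > 0"
  let ?l = "\<Sum>b\<in>Basis. (k \<bullet> b) *\<^sub>R dual_adjoint (directional_derivative b) (dirac x)"
  obtain C where C: "C \<ge> 0" "\<And>f n y h. f \<in> B \<Longrightarrow> n \<le> 2 \<Longrightarrow> y \<in> cball x 1 \<Longrightarrow> range h \<subseteq> Basis \<Longrightarrow>
      \<bar>iterated_derivative (smooth_apply f) n y h\<bar> \<le> C"
    using tvs_bounded_iterated_derivative[OF B compact_cball, of 2 x 1] by metis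
  \<comment> \<open>The first factor comes from expanding k in the basis; the bracket times
    \<bar>t\<bar> bounds the change of a first derivative between x and the intermediate
    point.\<close>
  define M where "M = real DIM('a) * norm k * (real DIM('a) * C * norm k)"
  have M: "M \<ge> 0" using C(1) by (simp add: M_def)
  have bound: "\<bar>dual_apply ((dirac (x + t *\<^sub>R k) - dirac x) /\<^sub>R t) f - dual_apply ?l f\<bar> < \<epsilon>"
    if "t \<noteq> 0" and t: "\<bar>t\<bar> < min (1 / (norm k + 1)) (\<epsilon> / (M + 1))" and f: "f \<in> B" for t f
  proof -
    let ?d = "gateaux_derivative (smooth_apply f)"
    obtain s where s: "\<bar>s\<bar> \<le> \<bar>t\<bar>" "smooth_apply f (x + t *\<^sub>R k) - smooth_apply f x = t * ?d (x + s *\<^sub>R k) k"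
      using gateaux_smooth_mvt[OF gateaux_smooth_apply] by blast
    \<comment> \<open>The bound \<open>1 / (norm k + 1)\<close> on \<bar>t\<bar> keeps the
      intermediate point in the unit ball, where C applies.\<close>
    have sk: "norm (s *\<^sub>R k) \<le> \<bar>t\<bar> * norm k"
      using s(1) by (simp add: mult_right_mono)
    also have "\<dots> \<le> \<bar>t\<bar> * (norm k + 1)" by (simp add: algebra_simps)
    also have "\<dots> \<le> 1"
      using t by (simp add: pos_less_divide_eq add_nonneg_pos less_imp_le)
    finally have in_ball: "x + s *\<^sub>R k \<in> cball x 1" by (simp add: dist_norm)
    have lip: "\<bar>?d (x + s *\<^sub>R k) b - ?d x b\<bar> \<le> real DIM('a) * C * norm k * \<bar>t\<bar>" if b: "b \<in> Basis" for b
    proof -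
      have "\<bar>?d (x + s *\<^sub>R k) b - ?d x b\<bar> \<le> real DIM('a) * C * norm (s *\<^sub>R k)"
        using iterated_derivative_lipschitz[OF gateaux_smooth_apply[of f] convex_cball _ in_ball,
            of x "\<lambda>_. b" 1 C] C(2)[OF f, of 2] b
        by (simp add: image_subset_iff numeral_2_eq_2)
      also have "\<dots> \<le> real DIM('a) * C * (\<bar>t\<bar> * norm k)"
        using sk C(1) by (intro mult_left_mono) auto
      finally show ?thesis by (simp add: mult_ac)
    qed
    have "dual_apply ((dirac (x + t *\<^sub>R k) - dirac x) /\<^sub>R t) f - dual_apply ?l f =
        ?d (x + s *\<^sub>R k) k - ?d x k"
      using s(2) \<open>t \<noteq> 0\<close>
      by (simp add: dual_apply_sum dual_apply_scaleR dual_apply_diff dirac.rep_eq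
          dual_apply_dual_adjoint[OF linear_directional_derivative continuous_directional_derivative]
          directional_derivative.rep_eq gateaux_derivative_Basis[OF gateaux_smooth_apply, of f x k])
    also have "\<dots> = (\<Sum>b\<in>Basis. (k \<bullet> b) * (?d (x + s *\<^sub>R k) b - ?d x b))"
      by (simp add: gateaux_derivative_Basis[OF gateaux_smooth_apply, of f _ k]
          sum_subtractf right_diff_distrib)
    also have "\<bar>\<dots>\<bar> \<le> (\<Sum>b\<in>Basis. \<bar>k \<bullet> b\<bar> * \<bar>?d (x + s *\<^sub>R k) b - ?d x b\<bar>)"
      unfolding abs_mult[symmetric] by (rule sum_abs)
    also have "\<dots> \<le> (\<Sum>b\<in>(Basis::'a set). norm k * (real DIM('a) * C * norm k * \<bar>t\<bar>))"
      using lip by (intro sum_mono mult_mono Basis_le_norm) auto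
    also have "\<dots> = M * \<bar>t\<bar>" by (simp add: M_def)
    also have "\<dots> \<le> (M + 1) * \<bar>t\<bar>" by (simp add: algebra_simps)
    also have "\<dots> < \<epsilon>" using t M by (simp add: field_simps)
    finally show ?thesis .
  qed
  have "min (1 / (norm k + 1)) (\<epsilon> / (M + 1)) > 0" using \<epsilon> M by (simp add: add_nonneg_pos)
  then show "\<forall>\<^sub>F t in at 0. \<forall>f\<in>B.
      \<bar>dual_apply ((dirac (x + t *\<^sub>R k) - dirac x) /\<^sub>R t) f - dual_apply ?l f\<bar> < \<epsilon>"
    unfolding eventually_at dist_real_def diff_zero
    by (intro exI[of _ "min (1 / (norm k + 1)) (\<epsilon> / (M + 1))"] conjI ballI impI bound) auto
qed

text \<open>A class of jointly continuous maps that contains \<open>dirac\<close> and is closed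
  under differentiation, as \<open>gateaux_smooth_coinduct\<close> asks. The operators A collect
  transposed partial derivatives, the coefficients c collect coordinates of the directions.\<close>

inductive dirac_terms :: "('a::euclidean_space \<Rightarrow> (nat \<Rightarrow> 'a) \<Rightarrow> 'a smooth_fun strong_dual) \<Rightarrow> bool" where
  zero: "dirac_terms (\<lambda>x h. 0)"
| base: "continuous_on UNIV c \<Longrightarrow> linear A \<Longrightarrow> continuous_on UNIV A \<Longrightarrow>
    dirac_terms (\<lambda>x h. c h *\<^sub>R A (dirac x))"
| add: "dirac_terms \<Phi> \<Longrightarrow> dirac_terms \<Psi> \<Longrightarrow> dirac_terms (\<lambda>x h. \<Phi> x h + \<Psi> x h)"

lemma dirac_terms_sum:
  "(\<And>i. i \<in> I \<Longrightarrow> dirac_terms (\<Phi> i)) \<Longrightarrow> dirac_terms (\<lambda>x h. \<Sum>i\<in>I. \<Phi> i x h)"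
  by (induction I rule: infinite_finite_induct) (auto intro: dirac_terms.intros)

lemma gateaux_smooth_dirac: "gateaux_smooth (dirac :: 'a::euclidean_space \<Rightarrow> _)"
proof (rule gateaux_smooth_coinduct[where P = dirac_terms])
  show "dirac_terms (\<lambda>x h. dirac x)"
    using dirac_terms.base[of "\<lambda>_. 1" "\<lambda>\<eta>. \<eta>"] linear_id[unfolded id_def] by simp
next
  show "continuous_on UNIV (\<lambda>(x, h). \<Phi> x h)" if "dirac_terms \<Phi>" for \<Phi> :: "'a \<Rightarrow> (nat \<Rightarrow> 'a) \<Rightarrow> _"
    using that
  proof induction
    case (base c A)
    have "continuous_on UNIV (\<lambda>p::'a \<times> (nat \<Rightarrow> 'a). c (snd p) *\<^sub>R A (dirac (fst p)))"
      by (intro continuous_on_tvs_scaleR continuous_on_compose2[OF base(1)] continuous_on_compose2[OF base(3)]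
          continuous_on_compose2[OF continuous_dirac] continuous_on_fst continuous_on_snd continuous_on_id) auto
    then show ?case by (simp add: case_prod_unfold)
  qed (auto simp: case_prod_unfold intro: continuous_on_add)
next
  show "\<exists>\<Psi>. dirac_terms \<Psi> \<and> (\<forall>x h. has_gateaux_derivative (\<lambda>y. \<Phi> y h) (\<Psi> x h) x (h n))"
    if "dirac_terms \<Phi>" for \<Phi> :: "'a \<Rightarrow> (nat \<Rightarrow> 'a) \<Rightarrow> _" and n
    using that
  proof induction
    case zero
    show ?case
      by (rule exI[of _ "\<lambda>x h. 0"]) (simp add: dirac_terms.zero has_gateaux_derivative_def)
  next
    case (base c A)
    let ?D = "\<lambda>b. dual_adjoint (directional_derivative b) :: 'a smooth_fun strong_dual \<Rightarrow> _"
    \<comment> \<open>Differentiation inserts one more transpose under A and multiplies the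
      coefficient by a coordinate of the direction \<open>h n\<close>.\<close>
    let ?\<Psi> = "\<lambda>x h. \<Sum>b\<in>Basis. (c h * (h n \<bullet> b)) *\<^sub>R A (?D b (dirac x))"
    have "dirac_terms ?\<Psi>"
    proof (intro dirac_terms_sum)
      fix b :: 'a assume b: "b \<in> Basis"
      have lin: "linear (?D b)" and cont: "continuous_on UNIV (?D b)"
        using b by (auto intro!: linear_dual_adjoint continuous_dual_adjoint linear_directional_derivative
            continuous_directional_derivative)
      have "continuous_on UNIV (\<lambda>h::nat \<Rightarrow> 'a. c h * (h n \<bullet> b))"
        by (intro continuous_on_mult base continuous_on_inner continuous_on_const
            continuous_on_product_then_coordinatewise[OF continuous_on_id])
      moreover have "linear (\<lambda>\<eta>. A (?D b \<eta>))"
        using linear_compose[OF lin base(2)] by (simp add: o_def)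
      moreover have "continuous_on UNIV (\<lambda>\<eta>. A (?D b \<eta>))"
        using continuous_on_compose2[OF base(3) cont] by simp
      ultimately show "dirac_terms (\<lambda>x h. (c h * (h n \<bullet> b)) *\<^sub>R A (?D b (dirac x)))"
        by (rule dirac_terms.base)
    qed
    moreover have "has_gateaux_derivative (\<lambda>y. c h *\<^sub>R A (dirac y)) (?\<Psi> x h) x (h n)" for x h
    proof -
      have "has_gateaux_derivative (\<lambda>y. c h *\<^sub>R A (dirac y))
          (c h *\<^sub>R A (\<Sum>b\<in>Basis. (h n \<bullet> b) *\<^sub>R ?D b (dirac x))) x (h n)"
        by (intro has_gateaux_derivative_linear_compose[OF linear_tvs_scaleR]
            has_gateaux_derivative_linear_compose[OF base(2,3)] has_gateaux_derivative_dirac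
            continuous_on_tvs_scaleR continuous_on_const continuous_on_id)
      then show ?thesis
        by (simp add: linear_sum[OF base(2)] linear_scale[OF base(2)] scaleR_sum_right)
    qed
    ultimately show ?case by blast
  next
    case (add \<Phi>1 \<Phi>2)
    then obtain \<Psi>1 \<Psi>2 where "dirac_terms \<Psi>1" "dirac_terms \<Psi>2"
      "\<And>x h. has_gateaux_derivative (\<lambda>y. \<Phi>1 y h) (\<Psi>1 x h) x (h n)"
      "\<And>x h. has_gateaux_derivative (\<lambda>y. \<Phi>2 y h) (\<Psi>2 x h) x (h n)"
      by blast
    then show ?case
      by (intro exI[of _ "\<lambda>x h. \<Psi>1 x h + \<Psi>2 x h"])
        (simp add: dirac_terms.add has_gateaux_derivative_add)
  qed
qed

text \<open>Pairing with f is continuous and linear, so it commutes with differentiation. Partial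
  derivatives at a point are thereby values of elements of the dual.\<close>

lemma dual_apply_iterated_derivative_dirac:
  "dual_apply (iterated_derivative dirac n x h) f = iterated_derivative (smooth_apply f) n x h"
  using gateaux_smooth_linear_compose(2)[OF linear_dual_apply_left continuous_dual_apply_left
      gateaux_smooth_dirac, of f n x h]
  by (simp add: dirac.rep_eq)

section \<open>Reflexivity of the space of smooth functions\<close>

text \<open>A form of Helly's lemma: p satisfies every linear inequality valid on the image of C
  under the \<phi> i, hence is a limit of points of that image. For an almost minimiser f of the
  squared distance, the residual is an almost separating direction; testing the inequality in that
  direction bounds the squared distance.\<close>

lemma helly_approximation:
  fixes \<phi> :: "'i \<Rightarrow> 'v::real_vector \<Rightarrow> real"
  assumes C: "convex C" "C \<noteq> {}" and I: "finite I"
    and lin: "\<And>i. i \<in> I \<Longrightarrow> linear (\<phi> i)"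
    and bdd: "\<And>i. i \<in> I \<Longrightarrow> \<exists>c. \<forall>f\<in>C. \<bar>\<phi> i f\<bar> \<le> c"
    and sep: "\<And>a s. (\<And>f. f \<in> C \<Longrightarrow> (\<Sum>i\<in>I. a i * \<phi> i f) \<le> s) \<Longrightarrow> (\<Sum>i\<in>I. a i * p i) \<le> s"
    and \<epsilon>: "\<epsilon> > 0"
  shows "\<exists>f\<in>C. (\<Sum>i\<in>I. (p i - \<phi> i f)\<^sup>2) < \<epsilon>"
proof (rule ccontr)
  define Q where "Q f = (\<Sum>i\<in>I. (p i - \<phi> i f)\<^sup>2)" for f
  assume "\<not> ?thesis"
  then have Q_ge: "Q f \<ge> \<epsilon>" if "f \<in> C" for f
    using that by (force simp: Q_def)
  obtain c where c: "\<And>i f. i \<in> I \<Longrightarrow> f \<in> C \<Longrightarrow> \<bar>\<phi> i f\<bar> \<le> c i"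
    using bdd by metis
  define M where "M = (\<Sum>i\<in>I. (2 * c i)\<^sup>2)"
  have "M \<ge> 0" unfolding M_def by (intro sum_nonneg) simp
  have M: "(\<Sum>i\<in>I. (\<phi> i g - \<phi> i f)\<^sup>2) \<le> M" if "f \<in> C" "g \<in> C" for f g
    unfolding M_def
  proof (rule sum_mono)
    fix i assume "i \<in> I"
    with c[OF this that(1)] c[OF this that(2)] have "\<bar>\<phi> i g - \<phi> i f\<bar> \<le> \<bar>2 * c i\<bar>" by linarith
    then show "(\<phi> i g - \<phi> i f)\<^sup>2 \<le> (2 * c i)\<^sup>2" by (rule abs_le_square_iff[THEN iffD1])
  qed
  \<comment> \<open>\<tau> is both the step length inside C and, squared, the tolerance for the
    minimum; dividing by \<tau> later leaves an error \<open>\<tau> * (1 + M)\<close>, at most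
    \<epsilon>.\<close>
  define \<tau> where "\<tau> = min 1 (\<epsilon> / (1 + M))"
  have \<tau>: "\<tau> > 0" "\<tau> \<le> 1" "\<tau> \<le> \<epsilon> / (1 + M)"
    using \<epsilon> \<open>M \<ge> 0\<close> by (auto simp: \<tau>_def)
  then have \<tau>_le: "\<tau> * (1 + M) \<le> \<epsilon>"
    using \<open>M \<ge> 0\<close> by (simp add: pos_le_divide_eq)
  have bb: "bdd_below (Q ` C)"
    using Q_ge by (intro bdd_belowI2[of _ \<epsilon>])
  have "\<exists>f\<in>C. Q f < (INF f\<in>C. Q f) + \<tau>\<^sup>2"
    using cINF_less_iff[OF C(2) bb, of "(INF f\<in>C. Q f) + \<tau>\<^sup>2"] \<tau>(1) by simp
  then obtain f where f: "f \<in> C" "Q f < (INF f\<in>C. Q f) + \<tau>\<^sup>2" by blast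
  define r where "r i = p i - \<phi> i f" for i
  have "(\<Sum>i\<in>I. r i * \<phi> i g) \<le> (\<Sum>i\<in>I. r i * \<phi> i f) + \<tau> * (1 + M) / 2" if g: "g \<in> C" for g
  proof -
    \<comment> \<open>Moving from f towards g by \<tau> lowers Q by less than
      \<open>\<tau>\<^sup>2\<close>, which bounds the first-order term of Q in that
      direction.\<close>
    let ?k = "(1 - \<tau>) *\<^sub>R f + \<tau> *\<^sub>R g"
    have "?k \<in> C" using C(1) f(1) g \<tau> by (simp add: convexD)
    then have "Q f < Q ?k + \<tau>\<^sup>2"
      using f(2) cINF_lower[OF bb, of ?k] by linarith
    also have "Q ?k = (\<Sum>i\<in>I. (r i)\<^sup>2 - 2 * \<tau> * (r i * (\<phi> i g - \<phi> i f)) + \<tau>\<^sup>2 * (\<phi> i g - \<phi> i f)\<^sup>2)"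
      unfolding Q_def
    proof (rule sum.cong[OF refl])
      fix i assume "i \<in> I"
      then have \<phi>: "\<phi> i ?k = (1 - \<tau>) * \<phi> i f + \<tau> * \<phi> i g"
        using lin by (simp add: linear_add linear_scale)
      show "(p i - \<phi> i ?k)\<^sup>2 = (r i)\<^sup>2 - 2 * \<tau> * (r i * (\<phi> i g - \<phi> i f)) + \<tau>\<^sup>2 * (\<phi> i g - \<phi> i f)\<^sup>2"
        unfolding r_def \<phi> by (simp add: power2_eq_square algebra_simps)
    qed
    also have "\<dots> = Q f - 2 * \<tau> * (\<Sum>i\<in>I. r i * (\<phi> i g - \<phi> i f)) + \<tau>\<^sup>2 * (\<Sum>i\<in>I. (\<phi> i g - \<phi> i f)\<^sup>2)"
      by (simp add: Q_def r_def sum.distrib sum_subtractf sum_distrib_left)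
    also have "\<dots> \<le> Q f - 2 * \<tau> * (\<Sum>i\<in>I. r i * (\<phi> i g - \<phi> i f)) + \<tau>\<^sup>2 * M"
      using M[OF f(1) g] by (intro add_left_mono mult_left_mono) auto
    finally have "\<tau> * (2 * (\<Sum>i\<in>I. r i * (\<phi> i g - \<phi> i f))) < \<tau> * (\<tau> * (1 + M))"
      by (simp add: power2_eq_square algebra_simps)
    then have "2 * (\<Sum>i\<in>I. r i * (\<phi> i g - \<phi> i f)) < \<tau> * (1 + M)"
      using \<tau>(1) by (simp only: mult_less_cancel_left_pos)
    then show ?thesis by (simp add: right_diff_distrib sum_subtractf)
  qed
  \<comment> \<open>With the residual r as coefficients, the two sums differ by exactly
    \<open>Q f\<close>, so \<open>Q f\<close> is at most \<epsilon> / 2, against the lower bound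
    \<epsilon>.\<close>
  then have "(\<Sum>i\<in>I. r i * p i) \<le> (\<Sum>i\<in>I. r i * \<phi> i f) + \<tau> * (1 + M) / 2"
    by (rule sep)
  moreover have "Q f = (\<Sum>i\<in>I. r i * p i) - (\<Sum>i\<in>I. r i * \<phi> i f)"
    unfolding Q_def r_def by (simp add: sum_subtractf[symmetric] power2_eq_square right_diff_distrib)
  ultimately show False
    using Q_ge[OF f(1)] \<tau>_le \<epsilon> by linarith
qed

text \<open>Only the first n entries of h matter, and they range over a finite set.\<close>

lemma finite_iterated_derivative_Basis:
  fixes f :: "'a::euclidean_space \<Rightarrow> 'b::{real_vector, t2_space}"
  shows "finite ((\<lambda>h. iterated_derivative f n x h) ` {h. range h \<subseteq> Basis})"
proof (rule finite_subset)
  show "(\<lambda>h. iterated_derivative f n x h) ` {h. range h \<subseteq> Basis} \<subseteq>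
      (\<lambda>h. iterated_derivative f n x h) ` ({..<n} \<rightarrow>\<^sub>E Basis)"
  proof (intro image_subsetI)
    fix h :: "nat \<Rightarrow> 'a" assume "h \<in> {h. range h \<subseteq> Basis}"
    then have "restrict h {..<n} \<in> {..<n} \<rightarrow>\<^sub>E Basis"
      by (simp add: restrict_PiE_iff image_subset_iff)
    moreover have "iterated_derivative f n x h = iterated_derivative f n x (restrict h {..<n})"
      by (intro iterated_derivative_cong) simp
    ultimately show "iterated_derivative f n x h \<in> (\<lambda>h. iterated_derivative f n x h) ` ({..<n} \<rightarrow>\<^sub>E Basis)"
      by blast
  qed
  show "finite ((\<lambda>h. iterated_derivative f n x h) ` ({..<n} \<rightarrow>\<^sub>E Basis))"
    by (intro finite_imageI finite_PiE) simp_all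
qed

text \<open>A continuous functional \<open>L\<close> on the dual is dominated by the support function of a bounded
  convex set \<open>C\<close>, so finitely many values of \<open>L\<close> can be approximated by evaluation at a single element
  of \<open>C\<close>. Matching \<open>L\<close> at \<open>\<eta>\<close> and at the derivatives of Dirac masses over a fine net forces that
  element to be close to \<open>z \<mapsto> L (dirac z)\<close> in finitely many derivatives.\<close>

theorem smooth_fun_reflexive:
  fixes L :: "'a::euclidean_space smooth_fun strong_dual \<Rightarrow> real"
  assumes lin: "linear L" and cont: "continuous_on UNIV L"
  shows "\<exists>f. \<forall>\<eta>. L \<eta> = dual_apply \<eta> f"
proof -
  let ?D = "iterated_derivative (dirac :: 'a \<Rightarrow> _)"
  note LD = gateaux_smooth_linear_compose[OF lin cont gateaux_smooth_dirac]
  \<comment> \<open>Testing at Dirac masses forces this candidate; it is smooth because L is linear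
    and continuous and \<open>dirac\<close> is smooth.\<close>
  define f0 where "f0 = Abs_smooth_fun (\<lambda>z. L (dirac z))"
  have f0: "smooth_apply f0 = (\<lambda>z. L (dirac z))"
    unfolding f0_def using LD(1) by (simp add: Abs_smooth_fun_inverse)
  have "open (L -` {-1<..<1})" "0 \<in> L -` {-1<..<1}"
    using open_vimage[OF _ cont] linear_0[OF lin] by auto
  then have "\<forall>\<^sub>F \<eta> in nhds 0. \<eta> \<in> L -` {-1<..<1}" by (rule eventually_nhds_in_open)
  then obtain B \<epsilon> where B: "tvs_bounded B" and \<epsilon>: "\<epsilon> > 0" and LB: "\<forall>\<eta>\<in>dual_nhd B \<epsilon> 0. \<eta> \<in> L -` {-1<..<1}"
    unfolding eventually_nhds_strong_dual by blast
  \<comment> \<open>Both signs turn a one-sided bound s on C into an absolute bound on B, and the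
    factor 2 / \<epsilon> makes that bound s * \<epsilon> / 2, strictly below s * \<epsilon> for s >
    0.\<close>
  define C where "C = convex hull (insert 0 ((\<lambda>f. (2 / \<epsilon>) *\<^sub>R f) ` B \<union> (\<lambda>f. - (2 / \<epsilon>) *\<^sub>R f) ` B))"
  have C: "convex C" "0 \<in> C" "\<And>f. f \<in> B \<Longrightarrow> (2 / \<epsilon>) *\<^sub>R f \<in> C" "\<And>f. f \<in> B \<Longrightarrow> - (2 / \<epsilon>) *\<^sub>R f \<in> C"
    unfolding C_def by (auto intro: hull_inc)
  \<comment> \<open>By homogeneity, \<bar>L\<bar> < 1 on the neighbourhood given by B becomes
    domination of L by the support function of C.\<close>
  have L_le: "L \<eta> < s" if s: "s > 0" and C_le: "\<And>f. f \<in> C \<Longrightarrow> dual_apply \<eta> f \<le> s" for \<eta> s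
  proof -
    have "\<bar>dual_apply \<eta> f / s\<bar> < \<epsilon>" if "f \<in> B" for f
    proof -
      have "\<bar>dual_apply \<eta> f\<bar> * 2 \<le> s * \<epsilon>"
        using C_le[OF C(3)[OF that]] C_le[OF C(4)[OF that]] \<epsilon>
        unfolding linear_scale[OF linear_dual_apply] by (auto simp: field_simps abs_if)
      moreover have "0 < s * \<epsilon>" using s \<epsilon> by simp
      ultimately have "\<bar>dual_apply \<eta> f\<bar> < s * \<epsilon>" by linarith
      then show ?thesis using s by (simp add: field_simps)
    qed
    then have "(1 / s) *\<^sub>R \<eta> \<in> dual_nhd B \<epsilon> 0"
      by (simp add: dual_nhd_def dual_apply_scaleR zero_strong_dual.rep_eq)
    then have "L ((1 / s) *\<^sub>R \<eta>) < 1" using LB by auto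
    then show ?thesis using s by (simp add: linear_scale[OF lin])
  qed
  \<comment> \<open>Preimages of intervals under a linear functional are convex, so a bound on B
    passes to the hull with factor 2 / \<epsilon>.\<close>
  have C_bound: "\<bar>dual_apply \<eta> f\<bar> \<le> 2 / \<epsilon> * c"
    if "c \<ge> 0" "\<And>g. g \<in> B \<Longrightarrow> \<bar>dual_apply \<eta> g\<bar> \<le> c" "f \<in> C" for \<eta> c f
  proof -
    have "C \<subseteq> dual_apply \<eta> -` {- (2 / \<epsilon> * c)..2 / \<epsilon> * c}"
      unfolding C_def
    proof (rule hull_minimal)
      show "convex (dual_apply \<eta> -` {- (2 / \<epsilon> * c)..2 / \<epsilon> * c})"
        by (intro convex_linear_vimage linear_dual_apply convex_real_interval)
      have mem: "t *\<^sub>R g \<in> dual_apply \<eta> -` {- (2 / \<epsilon> * c)..2 / \<epsilon> * c}" if "g \<in> B" "\<bar>t\<bar> = 2 / \<epsilon>" for g t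
      proof -
        have "\<bar>dual_apply \<eta> (t *\<^sub>R g)\<bar> \<le> 2 / \<epsilon> * c"
          unfolding linear_scale[OF linear_dual_apply] real_scaleR_def abs_mult that(2)
          using \<epsilon> \<open>\<And>g. g \<in> B \<Longrightarrow> \<bar>dual_apply \<eta> g\<bar> \<le> c\<close>[OF that(1)] by (intro mult_left_mono) auto
        then show ?thesis unfolding vimage_eq atLeastAtMost_iff by linarith
      qed
      have zero: "0 \<in> dual_apply \<eta> -` {- (2 / \<epsilon> * c)..2 / \<epsilon> * c}"
        using \<open>c \<ge> 0\<close> \<epsilon> by (simp add: linear_0[OF linear_dual_apply])
      show "insert 0 ((\<lambda>f. (2 / \<epsilon>) *\<^sub>R f) ` B \<union> (\<lambda>f. - (2 / \<epsilon>) *\<^sub>R f) ` B) \<subseteq>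
          dual_apply \<eta> -` {- (2 / \<epsilon> * c)..2 / \<epsilon> * c}"
        using \<epsilon> by (intro insert_subsetI Un_least image_subsetI zero mem) auto
    qed
    with that(3) show ?thesis by (auto simp: abs_le_iff)
  qed
  \<comment> \<open>An auxiliary f in C links the two sides: its pairing with \<eta> is within e of
    \<open>L \<eta>\<close> by approximation, and within e of the pairing with f0 because f - f0
    lies in a neighbourhood where \<eta> is small.\<close>
  have close: "\<bar>L \<eta> - dual_apply \<eta> f0\<bar> \<le> 2 * e" if e: "e > 0" for \<eta> e
  proof -
    have "open (dual_apply \<eta> -` {-e<..<e})" "0 \<in> dual_apply \<eta> -` {-e<..<e}"
      using open_vimage[OF _ continuous_dual_apply[of \<eta>]] linear_0[OF linear_dual_apply[of \<eta>]] e by auto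
    then have "\<forall>\<^sub>F f in nhds 0. f \<in> dual_apply \<eta> -` {-e<..<e}" by (rule eventually_nhds_in_open)
    then obtain K m \<delta> where K: "compact K" and \<delta>: "\<delta> > 0"
      and \<eta>: "\<forall>g\<in>smooth_nhd K m \<delta> 0. g \<in> dual_apply \<eta> -` {-e<..<e}"
      unfolding eventually_nhds_smooth_fun by blast
    \<comment> \<open>A ball around K supplies the convexity that the Lipschitz estimate
      uses.\<close>
    obtain R where R: "K \<subseteq> cball 0 R"
      using compact_imp_bounded[OF K] unfolding bounded_iff by (auto simp: subset_eq)
    obtain c1 where c1: "c1 \<ge> 0" "\<And>f n x h. f \<in> B \<Longrightarrow> n \<le> Suc m \<Longrightarrow> x \<in> cball 0 R \<Longrightarrow> range h \<subseteq> Basis \<Longrightarrow>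
        \<bar>iterated_derivative (smooth_apply f) n x h\<bar> \<le> c1"
      using tvs_bounded_iterated_derivative[OF B compact_cball, of "Suc m" 0 R] by metis
    obtain c2 where c2: "\<And>n x h. n \<le> Suc m \<Longrightarrow> x \<in> cball 0 R \<Longrightarrow> range h \<subseteq> Basis \<Longrightarrow>
        \<bar>iterated_derivative (smooth_apply f0) n x h\<bar> \<le> c2"
      using iterated_derivative_bounded[OF gateaux_smooth_apply compact_cball, of "Suc m" 0 R f0] by metis
    \<comment> \<open>A Lipschitz constant on the ball for the derivatives of f - f0 up to order m,
      valid for every f in C; hence the net T can be fixed before f is chosen.\<close>
    define M where "M = real DIM('a) * (2 / \<epsilon> * c1 + \<bar>c2\<bar>)"
    have M: "M \<ge> 0" using c1(1) \<epsilon> by (simp add: M_def)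
    define r where "r = \<delta> / (2 * (M + 1))"
    have r: "r > 0" "M * r < \<delta> / 2"
      using M \<delta> by (auto simp: r_def field_simps)
    obtain T where T: "T \<subseteq> K" "finite T" "K \<subseteq> (\<Union>x\<in>T. ball x r)"
      by (rule compactE_image[OF K, of K "\<lambda>x. ball x r"]) (use r(1) in auto)
    define I where "I = insert \<eta> (\<Union>n\<in>{..m}. \<Union>x\<in>T. (\<lambda>h. ?D n x h) ` {h. range h \<subseteq> Basis})"
    have "finite I"
      unfolding I_def using T(2) by (intro finite.insertI finite_UN_I finite_iterated_derivative_Basis) auto
    \<comment> \<open>The bound e is for the error at \<eta>. The bound \<delta> / 2 is for the net
      points; the other half of \<delta> pays for the distance to the net.\<close>
    define \<theta> where "\<theta> = min e (\<delta> / 2)"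
    have \<theta>: "\<theta> > 0" using e \<delta> by (simp add: \<theta>_def)
    have "\<exists>f\<in>C. (\<Sum>\<xi>\<in>I. (L \<xi> - dual_apply \<xi> f)\<^sup>2) < \<theta>\<^sup>2"
    proof (rule helly_approximation[OF C(1) _ \<open>finite I\<close> linear_dual_apply])
      show "\<exists>c. \<forall>f\<in>C. \<bar>dual_apply \<xi> f\<bar> \<le> c" for \<xi>
        using dual_apply_bounded[OF B, of \<xi>] C_bound by metis
    next
      fix a s assume *: "\<And>f. f \<in> C \<Longrightarrow> (\<Sum>\<xi>\<in>I. a \<xi> * dual_apply \<xi> f) \<le> s"
      have "s \<ge> 0" using *[OF C(2)] by (simp add: linear_0[OF linear_dual_apply])
      show "(\<Sum>\<xi>\<in>I. a \<xi> * L \<xi>) \<le> s"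
      \<comment> \<open>Since s may be 0, the slack u provides the strictly positive bound that
        \<open>L_le\<close> takes.\<close>
      proof (rule field_le_epsilon)
        fix u :: real assume "u > 0"
        have "L (\<Sum>\<xi>\<in>I. a \<xi> *\<^sub>R \<xi>) < s + u"
        proof (rule L_le)
          show "s + u > 0" using \<open>s \<ge> 0\<close> \<open>u > 0\<close> by simp
          show "dual_apply (\<Sum>\<xi>\<in>I. a \<xi> *\<^sub>R \<xi>) f \<le> s + u" if "f \<in> C" for f
            using *[OF that] \<open>u > 0\<close> by (simp add: dual_apply_sum dual_apply_scaleR)
        qed
        then show "(\<Sum>\<xi>\<in>I. a \<xi> * L \<xi>) \<le> s + u"
          by (simp add: linear_sum[OF lin] linear_scale[OF lin])
      qed
    qed (use C(2) \<theta> in auto)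
    then obtain f where f: "f \<in> C" "(\<Sum>\<xi>\<in>I. (L \<xi> - dual_apply \<xi> f)\<^sup>2) < \<theta>\<^sup>2" by blast
    have f_close: "\<bar>L \<xi> - dual_apply \<xi> f\<bar> < \<theta>" if "\<xi> \<in> I" for \<xi>
    proof -
      have "(L \<xi> - dual_apply \<xi> f)\<^sup>2 < \<theta>\<^sup>2"
        using member_le_sum[OF that, of "\<lambda>\<xi>. (L \<xi> - dual_apply \<xi> f)\<^sup>2"] \<open>finite I\<close> f(2) by fastforce
      then show ?thesis
        using \<theta> by (simp add: abs_square_less_1 power2_less_imp_less)
    qed
    have der: "iterated_derivative (smooth_apply (f - f0)) n x h =
        dual_apply (?D n x h) f - L (?D n x h)" for n x h
      unfolding smooth_apply_diff iterated_derivative_minus[OF gateaux_smooth_apply gateaux_smooth_apply]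
        dual_apply_iterated_derivative_dirac
      by (simp add: f0 LD(2))
    have "f - f0 \<in> smooth_nhd K m \<delta> 0"
      unfolding smooth_nhd_def
    proof (intro CollectI allI impI ballI)
      fix n x and h :: "nat \<Rightarrow> 'a" assume nxh: "n \<le> m" "x \<in> K" "range h \<subseteq> Basis"
      let ?g = "iterated_derivative (smooth_apply (f - f0))"
      obtain y where y: "y \<in> T" "dist y x < r" using T(3) nxh(2) by auto
      have "\<bar>?g (Suc n) z h\<bar> \<le> 2 / \<epsilon> * c1 + \<bar>c2\<bar>" if "z \<in> cball 0 R" "range h \<subseteq> Basis" for z h
      proof -
        have "\<bar>dual_apply (?D (Suc n) z h) f\<bar> \<le> 2 / \<epsilon> * c1"
          using nxh(1) that c1(2)
          by (intro C_bound[OF c1(1) _ f(1)]) (simp add: dual_apply_iterated_derivative_dirac del: iterated_derivative.simps)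
        moreover have "\<bar>L (?D (Suc n) z h)\<bar> \<le> c2"
          using c2[of "Suc n" z h] nxh(1) that by (simp add: f0 LD(2) del: iterated_derivative.simps)
        ultimately show ?thesis unfolding der by linarith
      qed
      moreover have "x \<in> cball 0 R" "y \<in> cball 0 R" using R T(1) y(1) nxh(2) by auto
      ultimately have "\<bar>?g n x h - ?g n y h\<bar> \<le> M * norm (x - y)"
        unfolding M_def
        by (intro iterated_derivative_lipschitz[OF gateaux_smooth_apply convex_cball] nxh(3))
      also have "\<dots> \<le> M * r"
        using y(2) M by (intro mult_left_mono) (auto simp: dist_norm norm_minus_commute)
      finally have "\<bar>?g n x h - ?g n y h\<bar> < \<delta> / 2" using r(2) by linarith
      moreover have "?D n y h \<in> I" unfolding I_def using nxh y(1) by blast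
      then have "\<bar>?g n y h\<bar> < \<delta> / 2"
        using f_close[of "?D n y h"] unfolding der \<theta>_def by linarith
      ultimately have "\<bar>?g n x h\<bar> < \<delta>" by linarith
      then show "\<bar>?g n x h - iterated_derivative (smooth_apply 0) n x h\<bar> < \<delta>"
        by (simp add: smooth_apply_zero iterated_derivative_const)
    qed
    then have "\<bar>dual_apply \<eta> f - dual_apply \<eta> f0\<bar> < e"
      using \<eta> by (auto simp: linear_diff[OF linear_dual_apply] abs_less_iff)
    moreover have "\<bar>L \<eta> - dual_apply \<eta> f\<bar> < e"
      using f_close[of \<eta>] by (simp add: I_def \<theta>_def)
    ultimately show ?thesis by linarith
  qed
  have "L \<eta> = dual_apply \<eta> f0" for \<eta>
  proof (rule ccontr)
    assume "L \<eta> \<noteq> dual_apply \<eta> f0"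
    with close[of "\<bar>L \<eta> - dual_apply \<eta> f0\<bar> / 4" \<eta>] show False by simp
  qed
  then show ?thesis by blast
qed

section \<open>The empirical measure\<close>

text \<open>Reflexivity applied to the derivative of F in its direction gives existence, and testing
  at Dirac masses gives uniqueness, so the definite description denotes.\<close>

lemma represents_functional_derivative:
  fixes F :: "'a::euclidean_space smooth_fun strong_dual \<Rightarrow> real"
  assumes F: "gateaux_smooth F"
  shows "represents_derivative F \<gamma> (functional_derivative F \<gamma>)"
proof -
  obtain f where f: "represents_derivative F \<gamma> f"
    using smooth_fun_reflexive[OF linear_gateaux_derivative[OF F] continuous_on_gateaux_derivative[OF F]]
    unfolding represents_derivative_def by blast
  show ?thesis
    unfolding functional_derivative_def
  proof (rule theI[of "represents_derivative F \<gamma>", OF f])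
    fix g assume "represents_derivative F \<gamma> g"
    then have "smooth_apply g z = smooth_apply f z" for z
      using f unfolding represents_derivative_def by (metis dirac.rep_eq)
    then show "g = f" by (simp add: smooth_apply_inject[symmetric] ext)
  qed
qed

lemma dual_apply_empirical_measure:
  "dual_apply (empirical_measure (z :: 'd::finite phase ^ 'n::finite)) f =
    (1 / real CARD('n)) * (\<Sum>i\<in>UNIV. smooth_apply f (z $ i))"
  by (simp add: empirical_measure_def dual_apply_scaleR dual_apply_sum dirac.rep_eq)

lemma linear_vec_nth: "linear (\<lambda>z. z $ i)"
  by (rule linearI) simp_all

lemma gateaux_smooth_empirical_measure: "gateaux_smooth empirical_measure"
  unfolding empirical_measure_def
  by (intro gateaux_smooth_linear_compose(1)[OF linear_tvs_scaleR] gateaux_smooth_sum_tvs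
      gateaux_smooth_compose_linear[OF linear_vec_nth _ gateaux_smooth_dirac]
      continuous_on_tvs_scaleR continuous_on_const continuous_on_id continuous_on_component)

text \<open>Pairing with f commutes with differentiation and turns the empirical measure into the
  average of f over the particles; along \<open>axis i k\<close> only the i-th summand
  varies.\<close>

lemma dual_apply_gateaux_derivative_empirical_measure:
  fixes z :: "'d::finite phase ^ 'n::finite"
  shows "dual_apply (gateaux_derivative empirical_measure z (axis i k)) f =
    (1 / real CARD('n)) * gateaux_derivative (smooth_apply f) (z $ i) k"
proof -
  let ?d = "\<lambda>j. gateaux_derivative (smooth_apply f) (z $ j) (axis i k $ j)"
  note sm = gateaux_smooth_has_gateaux_derivative[OF gateaux_smooth_apply]
  have "has_gateaux_derivative (\<lambda>z. \<Sum>j\<in>UNIV. smooth_apply f (z $ j)) (\<Sum>j\<in>UNIV. ?d j) z (axis i k)"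
    by (intro has_gateaux_derivative_sum has_gateaux_derivative_compose_linear[OF linear_vec_nth] sm)
  moreover have "?d j = (if j = i then gateaux_derivative (smooth_apply f) (z $ i) k else 0)" for j
    by (auto simp: axis_def linear_0[OF linear_gateaux_derivative[OF gateaux_smooth_apply]])
  ultimately have "has_gateaux_derivative (\<lambda>z. (1 / real CARD('n)) *\<^sub>R (\<Sum>j\<in>UNIV. smooth_apply f (z $ j)))
      ((1 / real CARD('n)) *\<^sub>R gateaux_derivative (smooth_apply f) (z $ i) k) z (axis i k)"
    by (intro has_gateaux_derivative_linear_compose[OF linear_tvs_scaleR] continuous_on_tvs_scaleR
        continuous_on_const continuous_on_id) simp
  moreover have "has_gateaux_derivative (\<lambda>z. dual_apply (empirical_measure z) f)
      (dual_apply (gateaux_derivative empirical_measure z (axis i k)) f) z (axis i k)"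
    by (intro has_gateaux_derivative_linear_compose[OF linear_dual_apply_left continuous_dual_apply_left]
        gateaux_smooth_has_gateaux_derivative gateaux_smooth_empirical_measure)
  ultimately show ?thesis
    unfolding dual_apply_empirical_measure by (auto dest!: gateaux_derivative_eqI)
qed

text \<open>The chain rule gives the derivative of F along a derivative of the empirical measure;
  representing it by the functional derivative reduces it to a pairing already computed.\<close>

lemma gateaux_derivative_compose_empirical_measure:
  fixes z :: "'d::finite phase ^ 'n::finite"
  assumes F: "gateaux_smooth F"
  shows "gateaux_derivative (F \<circ> empirical_measure) z (axis i k) = (1 / real CARD('n)) *
    gateaux_derivative (smooth_apply (functional_derivative F (empirical_measure z))) (z $ i) k"
proof -
  have "gateaux_derivative (F \<circ> empirical_measure) z (axis i k) =
      gateaux_derivative F (empirical_measure z) (gateaux_derivative empirical_measure z (axis i k))"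
    unfolding o_def
    by (intro gateaux_derivative_eqI has_gateaux_derivative_chain[OF F]
        gateaux_smooth_has_gateaux_derivative gateaux_smooth_empirical_measure)
  then show ?thesis
    using represents_functional_derivative[OF F, of "empirical_measure z"]
    by (simp add: represents_derivative_def dual_apply_gateaux_derivative_empirical_measure)
qed

lemma partial_grad_compose_empirical_measure:
  fixes z :: "'d::finite phase ^ 'n::finite"
  assumes "gateaux_smooth F"
  shows "partial_grad_x i (F \<circ> empirical_measure) z =
      (1 / real CARD('n)) *\<^sub>R grad_x (smooth_apply (functional_derivative F (empirical_measure z))) (z $ i)"
    and "partial_grad_v i (F \<circ> empirical_measure) z =
      (1 / real CARD('n)) *\<^sub>R grad_v (smooth_apply (functional_derivative F (empirical_measure z))) (z $ i)"
  unfolding partial_grad_x_def partial_grad_v_def grad_x_def grad_v_def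
    gateaux_derivative_compose_empirical_measure[OF assms]
  by (simp_all add: vec_eq_iff)

theorem proposition2p15:
  fixes \<iota> :: "'d::finite phase ^ 'n::finite \<Rightarrow> 'd phase smooth_fun strong_dual"
  defines "\<iota> \<equiv> empirical_measure"
  shows "gateaux_smooth \<iota> \<and>
    (\<forall>F G :: 'd phase smooth_fun strong_dual \<Rightarrow> real.
      gateaux_smooth F \<longrightarrow> gateaux_smooth G \<longrightarrow>
      particle_bracket (F \<circ> \<iota>) (G \<circ> \<iota>) = lie_poisson_bracket F G \<circ> \<iota>)"
  unfolding \<iota>_def
proof (intro conjI allI impI gateaux_smooth_empirical_measure ext)
  fix F G :: "'d phase smooth_fun strong_dual \<Rightarrow> real" and z :: "'d phase ^ 'n"
  assume F: "gateaux_smooth F" and G: "gateaux_smooth G"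
  let ?f = "functional_derivative F (empirical_measure z)"
  let ?g = "functional_derivative G (empirical_measure z)"
  let ?N = "real CARD('n)"
  have "particle_bracket (F \<circ> empirical_measure) (G \<circ> empirical_measure) z =
      ?N * (\<Sum>i\<in>UNIV. (1 / ?N) * ((1 / ?N) * smooth_apply (lie_bracket ?f ?g) (z $ i)))"
    unfolding particle_bracket_def partial_grad_compose_empirical_measure[OF F]
      partial_grad_compose_empirical_measure[OF G] lie_bracket.rep_eq inner_scaleR_left inner_scaleR_right
      right_diff_distrib ..
  also have "\<dots> = (1 / ?N) * (\<Sum>i\<in>UNIV. smooth_apply (lie_bracket ?f ?g) (z $ i))"
    by (simp add: sum_distrib_left[symmetric] sum_divide_distrib[symmetric])
  \<comment> \<open>The remaining average over particles is the pairing of the Lie bracket with the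
    empirical measure.\<close>
  finally show "particle_bracket (F \<circ> empirical_measure) (G \<circ> empirical_measure) z =
      (lie_poisson_bracket F G \<circ> empirical_measure) z"
    by (simp add: lie_poisson_bracket_def dual_apply_empirical_measure)
qed

end
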